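(* Over a finite field $\mathbb F_q$ of characteristic at least $5$ there are at most $6q-2$ equivalence classes of cubic rational expressions.
   Context: A rational expression $R(x)=g(x)/h(x)$ with $g,h$ coprime has degree $\max(\deg g,\deg h)$; cubic means degree $3$. The group $G(\mathbb F_q)=\mathrm{PGL}_2(\mathbb F_q)\times\mathrm{PGL}_2(\mathbb F_q)$, with $\mathrm{PGL}_2(\mathbb F_q)$ identified with the group of degree-one rational expressions (Möbius transformations) over $\mathbb F_q$ under composition, acts on $\mathbb F_q(x)$ by $(B,A)\cdot R(x)=B(R(A^{-1}(x)))$; the equivalence classes are the $G(\mathbb F_q)$-orbits. *)

theory Defs
  imports
    "HOL-Computational_Algebra.Computational_Algebra"
    "HOL-Algebra.Group_Action"
begin

text \<open>
  The rational expressions over a field are the elements of the fraction field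
  \<open>'a poly fract\<close>. Coprimality is that of the divisibility theory in \<open>'a poly\<close>, so a
  reduced form is unique up to a common nonzero constant factor of \<open>g\<close> and \<open>h\<close>.
\<close>

definition reduced_form :: "'a::field poly fract \<Rightarrow> 'a poly \<Rightarrow> 'a poly \<Rightarrow> bool" where
  "reduced_form R g h \<longleftrightarrow> coprime g h \<and> h \<noteq> 0 \<and> R = Fract g h"

lemma bezout_field_poly:
  fixes g h :: "'a::field poly"
  assumes "coprime g h"
  shows "\<exists>u v. u * g + v * h = 1"
proof -
  define I where "I = {p. p \<noteq> 0 \<and> (\<exists>u v. p = u * g + v * h)}"
  have "g \<noteq> 0 \<or> h \<noteq> 0" using assms by auto
  hence ne: "\<exists>p. p \<in> I" unfolding I_def
    by (metis (mono_tags, lifting) add.left_neutral add.right_neutral mem_Collect_eq mult_1 mult_zero_left)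
  then obtain p where p: "p \<in> I" and min: "\<And>q. q \<in> I \<Longrightarrow> degree p \<le> degree q"
    using arg_min_nat_lemma[of "\<lambda>p. p \<in> I" _ degree] by metis
  then obtain u v where uv: "p = u * g + v * h" and p0: "p \<noteq> 0" by (auto simp: I_def)
  have dvd: "p dvd a * g + b * h" for a b
  proof -
    let ?f = "a * g + b * h"
    have e: "?f mod p = (a - (?f div p) * u) * g + (b - (?f div p) * v) * h"
    proof -
      have "?f mod p = ?f - (?f div p) * p" by (simp add: minus_div_mult_eq_mod)
      also have "\<dots> = ?f - (?f div p) * (u * g + v * h)" using uv by metis
      finally show ?thesis by (simp add: algebra_simps)
    qed
    have "?f mod p = 0"
    proof (rule ccontr)
      assume n: "?f mod p \<noteq> 0"
      hence "?f mod p \<in> I" using e by (auto simp: I_def)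
      from min[OF this] degree_mod_less[OF p0, of ?f] n show False by auto
    qed
    thus ?thesis by (simp add: dvd_eq_mod_eq_0)
  qed
  have "p dvd g" "p dvd h" using dvd[of 1 0] dvd[of 0 1] by auto
  hence "is_unit p" using assms coprime_common_divisor by blast
  then obtain w where "1 = p * w" by (auto elim: dvdE)
  hence "(w * u) * g + (w * v) * h = 1" using uv by (simp add: algebra_simps)
  thus ?thesis by blast
qed

lemma coprime_dvd_mult_field_poly:
  fixes g h :: "'a::field poly"
  assumes "coprime g h" "h dvd g * k"
  shows "h dvd k"
proof -
  obtain u v where "u * g + v * h = 1" using bezout_field_poly[OF assms(1)] by blast
  hence "k = u * (g * k) + v * h * k"
    by (metis distrib_right mult.assoc mult_1)
  thus ?thesis using assms(2) by (metis dvd_add dvd_mult dvd_mult2 dvd_triv_right)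
qed

lemma reduced_form_unique:
  fixes R :: "'a::field poly fract"
  assumes "reduced_form R g h" "reduced_form R g' h'"
  shows "\<exists>c. c \<noteq> 0 \<and> g' = smult c g \<and> h' = smult c h"
proof -
  have c: "coprime g h" "coprime g' h'" and nz: "h \<noteq> 0" "h' \<noteq> 0" and "Fract g h = Fract g' h'"
    using assms by (auto simp: reduced_form_def)
  hence eq: "g * h' = g' * h" by (simp add: eq_fract)
  have "h dvd h'" using coprime_dvd_mult_field_poly[OF c(1)] eq by simp
  moreover have "h' dvd h" using coprime_dvd_mult_field_poly[OF c(2)] eq by (metis dvd_triv_right)
  ultimately have d: "degree h = degree h'" using nz by (simp add: dvd_imp_degree_le eq_iff)
  from \<open>h dvd h'\<close> obtain k where k: "h' = h * k" by blast
  with nz d have "degree k = 0" by (auto simp: degree_mult_eq)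
  then obtain a where a: "k = [:a:]" by (auto elim: degree_eq_zeroE)
  have h': "h' = smult a h" using k a by simp
  hence a0: "a \<noteq> 0" using nz by auto
  have "h * g' = h * smult a g" using eq h' by (simp add: mult.commute)
  hence "g' = smult a g" using nz(1) mult_left_cancel by blast
  thus ?thesis using h' a0 by blast
qed

lemma exists_reduced_form:
  fixes R :: "'a::field poly fract"
  shows "\<exists>g h. reduced_form R g h"
proof -
  define S where "S = (\<lambda>h. \<exists>g. h \<noteq> 0 \<and> R = Fract g h)"
  have "\<exists>h. S h" unfolding S_def by (cases R) auto
  then obtain h where h: "S h" and min: "\<And>h'. S h' \<Longrightarrow> degree h \<le> degree h'"
    using arg_min_nat_lemma[of S _ degree] by metis
  then obtain g where g: "h \<noteq> 0" "R = Fract g h" by (auto simp: S_def)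
  have "coprime g h"
  proof (rule coprimeI)
    fix c assume "c dvd g" "c dvd h"
    then obtain a b where ab: "g = c * a" "h = c * b" by (auto elim!: dvdE)
    have nz: "c \<noteq> 0" "b \<noteq> 0" using ab g by auto
    hence "S b" unfolding S_def using g ab by (auto simp: eq_fract intro!: exI[of _ a])
    from min[OF this] have "degree c = 0" using ab nz by (simp add: degree_mult_eq)
    thus "is_unit c" using nz by (simp add: is_unit_iff_degree)
  qed
  thus ?thesis using g by (auto simp: reduced_form_def)
qed

definition rat_degree :: "'a::field poly fract \<Rightarrow> nat" where
  "rat_degree R = (THE d. \<exists>g h. reduced_form R g h \<and> d = max (degree g) (degree h))"

lemma rat_degree_eq:
  fixes R :: "'a::field poly fract"
  assumes "reduced_form R g h"
  shows "rat_degree R = max (degree g) (degree h)"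
  unfolding rat_degree_def
proof (rule the_equality)
  fix d assume "\<exists>g h. reduced_form R g h \<and> d = max (degree g) (degree h)"
  then show "d = max (degree g) (degree h)"
    by (auto dest!: reduced_form_unique[OF assms])
qed (use assms in auto)

definition poly_at_rat :: "'a::field poly \<Rightarrow> 'a poly fract \<Rightarrow> 'a poly fract" where
  "poly_at_rat p S = poly (map_poly (\<lambda>c. to_fract [:c:]) p) S"

text \<open>
  \<open>rat_comp R S\<close> is \<open>R(S(x))\<close>. The value does not depend on the reduced form of \<open>R\<close>. If \<open>S\<close> is
  a constant at which \<open>R\<close> has a pole, the result is \<open>0\<close> because division by zero gives \<open>0\<close>; this
  case does not occur when \<open>S\<close> has positive degree.
\<close>

definition rat_comp :: "'a::field poly fract \<Rightarrow> 'a poly fract \<Rightarrow> 'a poly fract" where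
  "rat_comp R S = (THE T. \<exists>g h. reduced_form R g h \<and> T = poly_at_rat g S / poly_at_rat h S)"

lemma poly_at_rat_smult:
  "poly_at_rat (smult c p) S = to_fract [:c:] * poly_at_rat p S"
  unfolding poly_at_rat_def
proof -
  have "map_poly (\<lambda>c. to_fract [:c:]) (smult c p) = smult (to_fract [:c:]) (map_poly (\<lambda>c. to_fract [:c:]) p)"
    by (rule poly_eqI) (simp add: coeff_map_poly flip: to_fract_mult)
  thus "poly (map_poly (\<lambda>c. to_fract [:c:]) (smult c p)) S =
    to_fract [:c:] * poly (map_poly (\<lambda>c. to_fract [:c:]) p) S" by simp
qed

lemma rat_comp_eq:
  fixes R :: "'a::field poly fract"
  assumes "reduced_form R g h"
  shows "rat_comp R S = poly_at_rat g S / poly_at_rat h S"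
  unfolding rat_comp_def
proof (rule the_equality)
  fix T assume "\<exists>g h. reduced_form R g h \<and> T = poly_at_rat g S / poly_at_rat h S"
  then show "T = poly_at_rat g S / poly_at_rat h S"
    by (auto dest!: reduced_form_unique[OF assms] simp: poly_at_rat_smult to_fract_eq_0_iff)
qed (use assms in auto)

definition rat_X :: "'a::field poly fract" where
  "rat_X = to_fract [:0, 1:]"

definition PGL2 :: "'a::field poly fract monoid" where
  "PGL2 = \<lparr>carrier = {A. rat_degree A = 1}, mult = rat_comp, one = rat_X\<rparr>"

definition rat_action ::
    "'a::field poly fract \<times> 'a poly fract \<Rightarrow> 'a poly fract \<Rightarrow> 'a poly fract" where
  "rat_action = (\<lambda>(B, A) R. rat_comp B (rat_comp R (inv\<^bsub>PGL2\<^esub> A)))"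

end

theory Submission
  imports "HOL-Algebra.Algebraic_Closure_Type" Defs
begin

text \<open>
  A class is a pencil of binary cubics up to a change of the variable, and it is sorted by a
  ramification point \<open>\<alpha>\<close> of the expression over the algebraic closure. Write \<open>F\<close> for the
  Frobenius map. If \<open>\<alpha>\<close> is rational, it can be moved to infinity, and the remaining coordinate
  changes leave the forms \<open>x\<^sup>3 + p x\<close>, \<open>(x\<^sup>3 + x\<^sup>2 + d) / x\<close> and \<open>(x\<^sup>3 + d) / x\<close>; here
  \<open>p\<close> and \<open>p / 4\<close> give the same class, so there are at most \<open>1 + (q - 1) / 2 + 2 (q - 1)\<close> classes.

  If \<open>F\<^sup>2 \<alpha> = \<alpha>\<close>, then \<open>\<alpha>\<close> can be moved to a fixed point of the quadratic extension, and the
  class is determined by the third point \<open>\<gamma>\<close> of the fibre through \<open>\<alpha>\<close>. It is irrational of degree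
  2, and unless \<open>\<gamma> = \<alpha>\<close> the stabilizer of \<open>\<alpha>\<close> gives at least \<open>q\<close> such \<open>\<gamma>\<close> for each class.
  This leaves at most \<open>1 + (q\<^sup>2 - q) / q = q\<close> classes.

  Otherwise the Wronskian of the pencil is the quartic with the roots \<open>\<alpha>, F \<alpha>, F\<^sup>2 \<alpha>, F\<^sup>3 \<alpha>\<close>.
  It determines the pencil up to the solution of a quadratic equation, and each class has at
  least \<open>q\<^sup>2 (q - 1)\<close> such \<open>\<alpha>\<close>, namely the points \<open>a + b / (\<alpha> + c)\<close> with \<open>b \<noteq> 0\<close>. As there are at
  most \<open>q\<^sup>4\<close> points, this gives at most \<open>2 q + 2\<close> classes. The three bounds add up to at most
  \<open>6 q - 2\<close> because \<open>q \<ge> 5\<close>.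
\<close>

section \<open>Composition of rational expressions\<close>

lemma poly_at_rat_0 [simp]: "poly_at_rat 0 S = 0"
  by (simp add: poly_at_rat_def)

lemma poly_at_rat_pCons [simp]:
  "poly_at_rat (pCons a p) S = to_fract [:a:] + S * poly_at_rat p S"
  by (cases "a = 0 \<and> p = 0") (auto simp: poly_at_rat_def map_poly_pCons)

lemma poly_at_rat_add: "poly_at_rat (p + q) S = poly_at_rat p S + poly_at_rat q S"
proof (induction p arbitrary: q)
  case (pCons a p)
  note IH = pCons.IH
  show ?case
  proof (cases q)
    case (pCons b r)
    have "to_fract [:a + b:] = to_fract [:a:] + to_fract [:b:]"
      by (simp flip: to_fract_add)
    then show ?thesis using pCons by (simp add: IH algebra_simps)
  qed
qed simp

lemma poly_at_rat_mult: "poly_at_rat (p * q) S = poly_at_rat p S * poly_at_rat q S"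
  by (induction p) (simp_all add: poly_at_rat_add poly_at_rat_smult algebra_simps)

lemma poly_at_rat_1 [simp]: "poly_at_rat 1 S = 1"
  using poly_at_rat_pCons[of 1 0 S] by (simp flip: one_pCons del: poly_at_rat_pCons)

lemma poly_at_rat_X: "poly_at_rat p rat_X = to_fract p"
proof (induction p)
  case (pCons a p)
  have "pCons a p = [:a:] + [:0, 1:] * p" by simp
  then have "to_fract (pCons a p) = to_fract [:a:] + rat_X * to_fract p"
    unfolding rat_X_def by (metis to_fract_add to_fract_mult)
  then show ?case using pCons by simp
qed simp

lemma poly_at_rat_to_fract: "poly_at_rat p (to_fract q) = to_fract (pcompose p q)"
  by (induction p) (simp_all add: pcompose_pCons)

lemma poly_at_rat_sum:
  assumes "degree p \<le> n"
  shows "poly_at_rat p S = (\<Sum>i\<le>n. to_fract [:coeff p i:] * S ^ i)"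
proof -
  let ?q = "map_poly (\<lambda>c. to_fract [:c:]) p"
  have "poly ?q S = (\<Sum>i\<le>degree ?q. coeff ?q i * S ^ i)" by (rule poly_altdef)
  also have "\<dots> = (\<Sum>i\<le>n. coeff ?q i * S ^ i)"
    using assms by (intro sum.mono_neutral_left)
      (auto simp: coeff_map_poly coeff_eq_0 intro!: degree_le)
  finally show ?thesis by (simp add: poly_at_rat_def coeff_map_poly)
qed

text \<open>The binary form of degree \<open>n\<close> attached to \<open>p\<close>, evaluated at
  \<open>A\<close> and \<open>D\<close>. Since \<open>n\<close> is an explicit argument, a
  \<open>p\<close> of smaller degree counts as a form with roots at infinity.\<close>

definition homogenize :: "nat \<Rightarrow> 'a::field poly \<Rightarrow> 'a poly \<Rightarrow> 'a poly \<Rightarrow> 'a poly" where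
  "homogenize n p A D = (\<Sum>i\<le>n. smult (coeff p i) (A ^ i * D ^ (n - i)))"

lemma poly_at_rat_Fract:
  assumes "degree p \<le> n" "D \<noteq> 0"
  shows "poly_at_rat p (Fract A D) = Fract (homogenize n p A D) (D ^ n)"
proof -
  have pw: "to_fract (x ^ k) = to_fract x ^ k" for x :: "'a poly" and k
    by (induction k) simp_all
  have sm: "to_fract (smult c p) = to_fract [:c:] * to_fract p" for c and p :: "'a poly"
    by (simp flip: to_fract_mult)
  have "to_fract D ^ n * poly_at_rat p (Fract A D) = to_fract (homogenize n p A D)"
  proof -
    have key: "to_fract D ^ n * (to_fract A / to_fract D) ^ i
        = to_fract A ^ i * to_fract D ^ (n - i)" if "i \<le> n" for i
    proof -
      have "to_fract D ^ n = to_fract D ^ i * to_fract D ^ (n - i)"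
        using that by (simp flip: power_add)
      then show ?thesis using assms(2) by (simp add: field_simps)
    qed
    have "to_fract D ^ n * (to_fract [:coeff p i:] * (to_fract A / to_fract D) ^ i)
        = to_fract (smult (coeff p i) (A ^ i * D ^ (n - i)))" if "i \<le> n" for i
      by (subst mult.left_commute) (simp only: key[OF that] sm pw to_fract_mult)
    then show ?thesis
      unfolding poly_at_rat_sum[OF assms(1)] homogenize_def Fract_conv_to_fract
        sum_distrib_left to_fract_sum
      by (intro sum.cong) auto
  qed
  then show ?thesis using assms(2)
    by (simp add: Fract_conv_to_fract pw field_simps)
qed

text \<open>Reduction to lowest terms cancels a common factor \<open>k\<close>, and the degree drops
  by exactly \<open>degree k\<close>. Coprimality can therefore be read off from the degree of the
  fraction.\<close>

lemma rat_degree_Fract_le: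
  assumes "h \<noteq> 0"
  shows "rat_degree (Fract g h) \<le> max (degree g) (degree h)"
    and "rat_degree (Fract g h) = max (degree g) (degree h) \<Longrightarrow> coprime g h"
proof -
  obtain g0 h0 where r: "reduced_form (Fract g h) g0 h0" using exists_reduced_form by blast
  then have c: "coprime g0 h0" and h0: "h0 \<noteq> 0" and e: "g * h0 = g0 * h"
    using assms by (auto simp: reduced_form_def eq_fract)
  have "h0 dvd h" using coprime_dvd_mult_field_poly[OF c] e by (metis dvd_triv_right)
  then obtain k where k: "h = h0 * k" by blast
  with e h0 have g: "g = g0 * k" by (simp add: mult.left_commute)
  have k0: "k \<noteq> 0" using k assms by auto
  have d: "rat_degree (Fract g h) = max (degree g0) (degree h0)" by (rule rat_degree_eq[OF r])
  have dg: "degree g = (if g0 = 0 then 0 else degree g0 + degree k)"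
    and dh: "degree h = degree h0 + degree k"
    using g k k0 h0 by (auto simp: degree_mult_eq)
  show "rat_degree (Fract g h) \<le> max (degree g) (degree h)" using d dg dh by auto
  assume "rat_degree (Fract g h) = max (degree g) (degree h)"
  then have "degree k = 0" using d dg dh by (auto simp: max_def split: if_splits)
  then have u: "is_unit k" using k0 by (simp add: is_unit_iff_degree)
  then show "coprime g h" unfolding g k using c
    by (simp add: coprime_mult_left_iff coprime_mult_right_iff is_unit_left_imp_coprime is_unit_right_imp_coprime)
qed

text \<open>Transcendence of \<open>S\<close> over the constants: this keeps denominators nonzero
  when \<open>S\<close> is substituted into them.\<close>

definition nonconst :: "'a::field poly fract \<Rightarrow> bool" where
  "nonconst S \<longleftrightarrow> (\<forall>p. p \<noteq> 0 \<longrightarrow> poly_at_rat p S \<noteq> 0)"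

text \<open>This is the rational root argument. Clearing denominators in \<open>p(g / h) = 0\<close>
  gives that \<open>h\<close> divides a power of \<open>g\<close>, so \<open>h\<close> is constant
  by coprimality. Then \<open>S\<close> is a nonconstant polynomial, and composing \<open>p\<close>
  with it cannot give \<open>0\<close>.\<close>

lemma nonconst_if_rat_degree:
  assumes "rat_degree S \<ge> 1"
  shows "nonconst S"
  unfolding nonconst_def
proof (intro allI impI notI)
  fix p assume p: "p \<noteq> 0" and z: "poly_at_rat p S = 0"
  obtain g h where r: "reduced_form S g h" using exists_reduced_form by blast
  then have c: "coprime g h" and h: "h \<noteq> 0" and S: "S = Fract g h" by (auto simp: reduced_form_def)
  let ?n = "degree p"
  have "homogenize ?n p g h = 0"
    using poly_at_rat_Fract[of p ?n h g] z h S by (simp add: Fract_conv_to_fract)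
  moreover have "homogenize ?n p g h = smult (lead_coeff p) (g ^ ?n) +
      (\<Sum>i<?n. smult (coeff p i) (g ^ i * h ^ (?n - i)))"
    by (simp add: homogenize_def flip: lessThan_Suc_atMost)
  moreover have "h dvd (\<Sum>i<?n. smult (coeff p i) (g ^ i * h ^ (?n - i)))"
    by (intro dvd_sum dvd_smult dvd_mult) (simp add: dvd_power)
  ultimately have "h dvd smult (lead_coeff p) (g ^ ?n)"
    by (metis add_eq_0_iff dvd_minus_iff)
  then have "h dvd g ^ ?n" using p by (simp add: dvd_smult_iff)
  moreover have "h dvd g ^ k \<Longrightarrow> h dvd 1" for k
    by (induction k) (simp, metis coprime_dvd_mult_field_poly[OF c] power_Suc)
  ultimately have "h dvd 1" by blast
  then have "degree h = 0" using h by (simp add: is_unit_iff_degree)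
  then obtain a where a: "h = [:a:]" "a \<noteq> 0" using h by (metis degree_eq_zeroE pCons_eq_0_iff)
  have dg: "degree g > 0" using rat_degree_eq[OF r] assms a by auto
  have "S = to_fract (smult (inverse a) g)"
    using a S by (simp add: to_fract_def eq_fract)
  then have "pcompose p (smult (inverse a) g) = 0" using z by (simp add: poly_at_rat_to_fract)
  moreover have "degree (smult (inverse a) g) > 0" using a dg by simp
  ultimately show False using p pcompose_eq_0 by blast
qed

lemma rat_comp_Fract:
  assumes S: "nonconst S" and h: "h \<noteq> 0"
  shows "rat_comp (Fract g h) S = poly_at_rat g S / poly_at_rat h S"
proof -
  obtain g0 h0 where r: "reduced_form (Fract g h) g0 h0" using exists_reduced_form by blast
  then have h0: "h0 \<noteq> 0" and e: "g * h0 = g0 * h"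
    using h by (auto simp: reduced_form_def eq_fract)
  have "poly_at_rat g S * poly_at_rat h0 S = poly_at_rat g0 S * poly_at_rat h S"
    using e by (metis poly_at_rat_mult)
  moreover have "poly_at_rat h S \<noteq> 0" "poly_at_rat h0 S \<noteq> 0"
    using S h h0 by (auto simp: nonconst_def)
  ultimately show ?thesis unfolding rat_comp_eq[OF r] by (simp add: field_simps)
qed

text \<open>Substitution of a transcendental \<open>T\<close> is a field homomorphism, which reduces
  associativity of composition to polynomials in the outer argument.\<close>

lemma rat_comp_hom:
  assumes T: "nonconst T"
  shows "rat_comp (R + S) T = rat_comp R T + rat_comp S T"
    and "rat_comp (R * S) T = rat_comp R T * rat_comp S T"
    and "rat_comp (to_fract p) T = poly_at_rat p T"
    and "R \<noteq> 0 \<Longrightarrow> rat_comp R T \<noteq> 0"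
    and "rat_comp (R / S) T = rat_comp R T / rat_comp S T"
proof -
  have nz: "poly_at_rat p T \<noteq> 0" if "p \<noteq> 0" for p using T that by (simp add: nonconst_def)
  show add: "rat_comp (R + S) T = rat_comp R T + rat_comp S T" for R S
    by (cases R; cases S)
       (simp add: rat_comp_Fract[OF T] poly_at_rat_add poly_at_rat_mult nz add_frac_eq)
  show mult: "rat_comp (R * S) T = rat_comp R T * rat_comp S T" for R S
    by (cases R; cases S) (simp add: rat_comp_Fract[OF T] poly_at_rat_mult)
  show tf: "rat_comp (to_fract p) T = poly_at_rat p T" for p
    using rat_comp_Fract[OF T, of 1 p] by (simp add: to_fract_def)
  show nzr: "rat_comp R T \<noteq> 0" if "R \<noteq> 0" for R
    using that by (cases R rule: Fract_cases_nonzero) (simp_all add: rat_comp_Fract[OF T] nz)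
  have zero: "rat_comp 0 T = 0" using tf[of 0] by simp
  show "rat_comp (R / S) T = rat_comp R T / rat_comp S T"
  proof (cases "S = 0")
    case False
    then have "rat_comp (R / S) T * rat_comp S T = rat_comp R T" by (simp flip: mult)
    with nzr[OF False] show ?thesis by (simp add: field_simps)
  qed (simp add: zero)
qed

lemma rat_comp_poly_at_rat:
  assumes "nonconst T"
  shows "rat_comp (poly_at_rat p S) T = poly_at_rat p (rat_comp S T)"
proof (induction p)
  case 0
  then show ?case using rat_comp_hom(3)[OF assms, of 0] by simp
next
  case (pCons a p)
  then show ?case using rat_comp_hom[OF assms] by simp
qed

lemma rat_comp_assoc:
  assumes "nonconst S" "nonconst T"
  shows "rat_comp (rat_comp R S) T = rat_comp R (rat_comp S T)"
proof -
  have "nonconst (rat_comp S T)" unfolding nonconst_def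
    using assms by (metis nonconst_def rat_comp_hom(4) rat_comp_poly_at_rat)
  then show ?thesis
    by (cases R) (simp add: rat_comp_Fract assms rat_comp_hom(5) rat_comp_poly_at_rat)
qed

section \<open>Degree-one expressions and classes\<close>

definition mob :: "'a::field \<Rightarrow> 'a \<Rightarrow> 'a \<Rightarrow> 'a \<Rightarrow> 'a poly fract" where
  "mob a b c d = Fract [:b, a:] [:d, c:]"

lemma mob_denominator: "a * d - b * c \<noteq> 0 \<Longrightarrow> [:d, c:] \<noteq> (0::'a::field poly)"
  by auto

lemma rat_degree_mob:
  fixes a b c d :: "'a::field"
  assumes "a * d - b * c \<noteq> 0"
  shows "rat_degree (mob a b c d) = 1"
proof -
  have "coprime [:b, a:] [:d, c:]"
  proof (rule coprimeI)
    fix e assume "e dvd [:b, a:]" "e dvd [:d, c:]"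
    then have "e dvd smult a [:d, c:] - smult c [:b, a:]" by (intro dvd_diff dvd_smult)
    then have "e dvd [:a * d - b * c:]" by (simp add: mult.commute)
    moreover have "is_unit [:a * d - b * c:]" using assms by (subst is_unit_iff_degree) auto
    ultimately show "is_unit e" by (rule dvd_trans)
  qed
  then have "reduced_form (mob a b c d) [:b, a:] [:d, c:]"
    using mob_denominator[OF assms] by (simp add: reduced_form_def mob_def)
  then show ?thesis using rat_degree_eq assms by fastforce
qed

lemma PGL2_simps [simp]:
  "A \<in> carrier PGL2 \<longleftrightarrow> rat_degree A = 1" "A \<otimes>\<^bsub>PGL2\<^esub> B = rat_comp A B" "\<one>\<^bsub>PGL2\<^esub> = rat_X"
  by (simp_all add: PGL2_def)

lemma degree_le_1_imp: "degree p \<le> 1 \<Longrightarrow> p = [:coeff p 0, coeff p 1:]"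
  by (rule poly_eqI) (auto simp: coeff_pCons coeff_eq_0 split: nat.split)

lemma rat_degree_1_mobE:
  fixes A :: "'a::field poly fract"
  assumes "rat_degree A = 1"
  obtains a b c d where "a * d - b * c \<noteq> 0" "A = mob a b c d"
proof -
  obtain g h where r: "reduced_form A g h" using exists_reduced_form by blast
  then have co: "coprime g h" and h: "h \<noteq> 0" and A: "A = Fract g h"
    by (auto simp: reduced_form_def)
  have m: "max (degree g) (degree h) = 1" using rat_degree_eq[OF r] assms by simp
  obtain a b c d where g: "g = [:b, a:]" and hd: "h = [:d, c:]"
    using degree_le_1_imp[of g] degree_le_1_imp[of h] m by (metis max.cobounded1 max.cobounded2)
  have "a * d - b * c \<noteq> 0"
  proof
    assume z: "a * d - b * c = 0"
    show False
    proof (cases "c = 0")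
      case True
      then have "d \<noteq> 0" using h hd by auto
      then have "a = 0" using z True by simp
      then show False using m g hd True by simp
    next
      case False
      then have "g = smult (a / c) h" unfolding g hd using z by (simp add: field_simps)
      then have "h dvd g" by (simp add: dvd_smult)
      from coprime_common_divisor[OF co this] have "is_unit h" by simp
      then show False using h hd False by (simp add: is_unit_iff_degree)
    qed
  qed
  then show ?thesis using that g hd A by (simp add: mob_def)
qed

text \<open>Left composition is a linear change of basis of the pair \<open>g\<close>,
  \<open>h\<close>, so the class depends only on the pencil that they span.\<close>

lemma rat_comp_mob_left:
  fixes g h :: "'a::field poly"
  assumes det: "a * d - b * c \<noteq> 0" and S: "nonconst (Fract g h)" and h: "h \<noteq> 0"
  shows "smult c g + smult d h \<noteq> 0"
    and "rat_comp (mob a b c d) (Fract g h) = Fract (smult a g + smult b h) (smult c g + smult d h)"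
proof -
  have e: "poly_at_rat [:y, x:] (Fract g h) = Fract (smult x g + smult y h) h" for x y
    using h by (simp add: Fract_conv_to_fract field_simps flip: to_fract_mult to_fract_add)
  have "poly_at_rat [:d, c:] (Fract g h) \<noteq> 0"
    using S mob_denominator[OF det] unfolding nonconst_def by blast
  then show nz: "smult c g + smult d h \<noteq> 0" unfolding e using h by (auto simp: Zero_fract_def eq_fract)
  show "rat_comp (mob a b c d) (Fract g h) = Fract (smult a g + smult b h) (smult c g + smult d h)"
    unfolding mob_def rat_comp_Fract[OF S mob_denominator[OF det]] e
    using h nz by (simp add: eq_fract)
qed

lemma nonconst_mob: "a * d - b * c \<noteq> 0 \<Longrightarrow> nonconst (mob a b c d)"
  by (simp add: nonconst_if_rat_degree rat_degree_mob)

lemma rat_comp_mob_mob: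
  fixes a b c d :: "'a::field"
  assumes "a * d - b * c \<noteq> 0" "a' * d' - b' * c' \<noteq> 0"
  shows "rat_comp (mob a b c d) (mob a' b' c' d') =
    mob (a * a' + b * c') (a * b' + b * d') (c * a' + d * c') (c * b' + d * d')"
  using rat_comp_mob_left(2)[OF assms(1) nonconst_mob[OF assms(2), unfolded mob_def]
      mob_denominator[OF assms(2)]]
  by (simp add: mob_def add.commute)

lemma rat_X_mob: "rat_X = mob 1 0 0 1"
  by (simp add: mob_def rat_X_def to_fract_def one_pCons)

lemma rat_comp_X_right: "rat_comp R rat_X = R"
proof -
  have X: "nonconst (rat_X :: 'a poly fract)" unfolding rat_X_mob by (rule nonconst_mob) simp
  show ?thesis by (cases R) (simp add: rat_comp_Fract[OF X] poly_at_rat_X, simp add: Fract_conv_to_fract)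
qed

lemma rat_comp_X_left: "nonconst R \<Longrightarrow> rat_comp rat_X R = R"
  unfolding rat_X_mob by (cases R) (auto simp: rat_comp_mob_left)

lemma mob_scale: "k \<noteq> 0 \<Longrightarrow> mob k 0 0 k = (rat_X :: 'a::field poly fract)"
  by (simp add: rat_X_mob mob_def eq_fract)

lemma group_PGL2: "group (PGL2 :: 'a::field poly fract monoid)"
proof (rule groupI)
  fix A B :: "'a poly fract" assume "A \<in> carrier PGL2" "B \<in> carrier PGL2"
  then obtain a b c d a' b' c' d' where 1: "a * d - b * c \<noteq> 0" "A = mob a b c d"
      and 2: "a' * d' - b' * c' \<noteq> 0" "B = mob a' b' c' d'"
    using rat_degree_1_mobE by (metis PGL2_simps(1))
  have "(a * a' + b * c') * (c * b' + d * d') - (a * b' + b * d') * (c * a' + d * c') =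
      (a * d - b * c) * (a' * d' - b' * c')" by (simp add: algebra_simps)
  also have "\<dots> \<noteq> 0" using 1(1) 2(1) by simp
  finally show "A \<otimes>\<^bsub>PGL2\<^esub> B \<in> carrier PGL2"
    using 1 2 by (simp add: rat_comp_mob_mob rat_degree_mob)
next
  show "\<one>\<^bsub>PGL2\<^esub> \<in> carrier PGL2" by (simp add: rat_X_mob rat_degree_mob)
next
  fix A B C :: "'a poly fract"
  assume "A \<in> carrier PGL2" "B \<in> carrier PGL2" "C \<in> carrier PGL2"
  then show "A \<otimes>\<^bsub>PGL2\<^esub> B \<otimes>\<^bsub>PGL2\<^esub> C = A \<otimes>\<^bsub>PGL2\<^esub> (B \<otimes>\<^bsub>PGL2\<^esub> C)"
    by (simp add: rat_comp_assoc nonconst_if_rat_degree)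
next
  fix A :: "'a poly fract" assume "A \<in> carrier PGL2"
  then show "\<one>\<^bsub>PGL2\<^esub> \<otimes>\<^bsub>PGL2\<^esub> A = A" by (simp add: rat_comp_X_left nonconst_if_rat_degree)
next
  fix A :: "'a poly fract" assume "A \<in> carrier PGL2"
  then obtain a b c d where 1: "a * d - b * c \<noteq> 0" "A = mob a b c d"
    using rat_degree_1_mobE by (metis PGL2_simps(1))
  \<comment> \<open>The inverse is given by the adjugate matrix; the product is the determinant
    times the identity matrix, which \<open>mob_scale\<close> identifies with
    \<open>rat_X\<close>.\<close>
  have 2: "d * a - (- b) * (- c) \<noteq> 0" using 1(1) by (simp add: mult.commute)
  have "rat_comp (mob d (- b) (- c) a) A = rat_X"
    unfolding 1(2) rat_comp_mob_mob[OF 2 1(1)]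
    using mob_scale[OF 1(1)] by (simp add: mult.commute)
  then show "\<exists>B\<in>carrier PGL2. B \<otimes>\<^bsub>PGL2\<^esub> A = \<one>\<^bsub>PGL2\<^esub>"
    using rat_degree_mob[OF 2] by auto
qed

section \<open>Substitution of Moebius transformations and invariance of the degree\<close>

lemma degree_homogenize_le:
  assumes "degree A \<le> 1" "degree D \<le> 1"
  shows "degree (homogenize n p A D) \<le> n"
  unfolding homogenize_def
proof (rule degree_sum_le)
  fix i assume "i \<in> {..n}"
  have "degree (A ^ i * D ^ (n - i)) \<le> degree A * i + degree D * (n - i)"
    by (meson add_mono degree_mult_le degree_power_le order_trans)
  also have "\<dots> \<le> 1 * i + 1 * (n - i)"
    by (intro add_mono mult_right_mono assms) auto
  finally show "degree (smult (coeff p i) (A ^ i * D ^ (n - i))) \<le> n"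
    using \<open>i \<in> {..n}\<close> by (intro order.trans[OF degree_smult_le]) simp
qed simp

text \<open>Numerator and denominator are homogenized to the same degree \<open>n\<close>, so the
  factors \<open>[:d, c:] ^ n\<close> cancel.\<close>

lemma rat_comp_mob_right:
  fixes g h :: "'a::field poly"
  assumes det: "a * d - b * c \<noteq> 0" and h: "h \<noteq> 0" and d: "degree g \<le> n" "degree h \<le> n"
  shows "homogenize n h [:b, a:] [:d, c:] \<noteq> 0"
    and "rat_comp (Fract g h) (mob a b c d) =
      Fract (homogenize n g [:b, a:] [:d, c:]) (homogenize n h [:b, a:] [:d, c:])"
proof -
  have nc: "nonconst (mob a b c d)" using det by (rule nonconst_mob)
  have nz: "[:d, c:] ^ n \<noteq> 0" using mob_denominator[OF det] by (rule power_not_zero)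
  have "poly_at_rat h (mob a b c d) \<noteq> 0" using nc h by (simp add: nonconst_def)
  then show 1: "homogenize n h [:b, a:] [:d, c:] \<noteq> 0"
    unfolding mob_def poly_at_rat_Fract[OF d(2) mob_denominator[OF det]]
    using nz by (auto simp: Zero_fract_def eq_fract)
  show "rat_comp (Fract g h) (mob a b c d) =
      Fract (homogenize n g [:b, a:] [:d, c:]) (homogenize n h [:b, a:] [:d, c:])"
    unfolding mob_def rat_comp_Fract[OF nc[unfolded mob_def] h]
      poly_at_rat_Fract[OF d(1) mob_denominator[OF det]] poly_at_rat_Fract[OF d(2) mob_denominator[OF det]]
    using nz 1 by (simp add: eq_fract)
qed

text \<open>Substitution of a Moebius transformation never raises the degree; applying this to its
  inverse as well gives equality.\<close>

lemma rat_degree_rat_comp_right: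
  fixes R :: "'a::field poly fract"
  assumes "A \<in> carrier PGL2"
  shows "rat_degree (rat_comp R A) = rat_degree R"
proof -
  interpret group "PGL2 :: 'a poly fract monoid" by (rule group_PGL2)
  have le: "rat_degree (rat_comp R A) \<le> rat_degree R" if "A \<in> carrier PGL2" for R A :: "'a poly fract"
  proof -
    obtain g h where r: "reduced_form R g h" using exists_reduced_form by blast
    then have h: "h \<noteq> 0" and R: "R = Fract g h" by (auto simp: reduced_form_def)
    have "rat_degree A = 1" using that(1) by simp
    then obtain a b c d where det: "a * d - b * c \<noteq> 0" and A: "A = mob a b c d"
      by (rule rat_degree_1_mobE)
    let ?n = "rat_degree R"
    have "degree g \<le> ?n" "degree h \<le> ?n" using rat_degree_eq[OF r] by auto
    from rat_comp_mob_right[OF det h this]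
    have "rat_degree (rat_comp R A) \<le> max (degree (homogenize ?n g [:b, a:] [:d, c:]))
        (degree (homogenize ?n h [:b, a:] [:d, c:]))"
      using rat_degree_Fract_le(1) A R by metis
    also have "\<dots> \<le> ?n" by (simp add: degree_homogenize_le)
    finally show ?thesis .
  qed
  have "rat_comp (rat_comp R A) (inv\<^bsub>PGL2\<^esub> A) = R"
    using assms r_inv[OF assms] inv_closed[OF assms]
    by (simp add: rat_comp_assoc nonconst_if_rat_degree rat_comp_X_right)
  then show ?thesis using le[OF assms, of R] le[OF inv_closed[OF assms], of "rat_comp R A"] by simp
qed

lemma rat_degree_rat_comp_left:
  fixes R :: "'a::field poly fract"
  assumes "B \<in> carrier PGL2" "rat_degree R \<ge> 1"
  shows "rat_degree (rat_comp B R) = rat_degree R"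
proof -
  interpret group "PGL2 :: 'a poly fract monoid" by (rule group_PGL2)
  have le: "rat_degree (rat_comp B R) \<le> rat_degree R" if "B \<in> carrier PGL2" "nonconst R" for R B :: "'a poly fract"
  proof -
    obtain g h where r: "reduced_form R g h" using exists_reduced_form by blast
    then have h: "h \<noteq> 0" and R: "R = Fract g h" by (auto simp: reduced_form_def)
    have "rat_degree B = 1" using that(1) by simp
    then obtain a b c d where det: "a * d - b * c \<noteq> 0" and B: "B = mob a b c d"
      by (rule rat_degree_1_mobE)
    let ?n = "rat_degree R"
    have "degree g \<le> ?n" "degree h \<le> ?n" using rat_degree_eq[OF r] by auto
    then have "degree (smult x g + smult y h) \<le> ?n" for x y
      by (meson degree_add_le degree_smult_le order_trans)
    then have "max (degree (smult a g + smult b h)) (degree (smult c g + smult d h)) \<le> ?n"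
      by simp
    then show ?thesis
      using rat_comp_mob_left[OF det that(2)[unfolded R] h] rat_degree_Fract_le(1) B R
      by (metis order_trans)
  qed
  have nc: "nonconst R" using assms(2) by (rule nonconst_if_rat_degree)
  have B: "nonconst B" "nonconst (inv\<^bsub>PGL2\<^esub> B)"
    using assms(1) inv_closed[OF assms(1)] by (simp_all add: nonconst_if_rat_degree)
  have nc2: "nonconst (rat_comp B R)"
    unfolding nonconst_def using nc B by (metis nonconst_def rat_comp_hom(4) rat_comp_poly_at_rat)
  have "rat_comp (inv\<^bsub>PGL2\<^esub> B) (rat_comp B R) = R"
    using l_inv[OF assms(1)] B nc by (simp add: rat_comp_X_left flip: rat_comp_assoc)
  then show ?thesis
    using le[OF assms(1) nc] le[OF inv_closed[OF assms(1)] nc2] by simp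
qed

text \<open>The orbit, written without the inverse in the action: as \<open>A\<close> runs over the
  group, so does its inverse. Coordinate changes can then be computed directly.\<close>

definition rat_class :: "'a::field poly fract \<Rightarrow> 'a poly fract set" where
  "rat_class R = {rat_comp B (rat_comp R A) | A B. A \<in> carrier PGL2 \<and> B \<in> carrier PGL2}"

lemma orbit_eq_rat_class:
  fixes R :: "'a::field poly fract"
  shows "orbit (PGL2 \<times>\<times> PGL2) rat_action R = rat_class R"
proof -
  interpret group "PGL2 :: 'a poly fract monoid" by (rule group_PGL2)
  show ?thesis
  proof (intro equalityI subsetI)
    fix T assume "T \<in> orbit (PGL2 \<times>\<times> PGL2) rat_action R"
    then show "T \<in> rat_class R"
      unfolding orbit_def rat_class_def rat_action_def DirProd_def
      using inv_closed by fastforce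
  next
    fix T assume "T \<in> rat_class R"
    then obtain A B where AB: "A \<in> carrier PGL2" "B \<in> carrier PGL2"
      and T: "T = rat_comp B (rat_comp R A)" by (auto simp: rat_class_def)
    have "T = rat_action (B, inv\<^bsub>PGL2\<^esub> A) R" using AB(1) by (simp add: rat_action_def T)
    moreover have "(B, inv\<^bsub>PGL2\<^esub> A) \<in> carrier (PGL2 \<times>\<times> PGL2)"
      using AB inv_closed[OF AB(1)] by (simp add: DirProd_def)
    ultimately show "T \<in> orbit (PGL2 \<times>\<times> PGL2) rat_action R" unfolding orbit_def by blast
  qed
qed

lemma rat_class_rat_comp_subset:
  fixes R :: "'a::field poly fract"
  assumes R: "rat_degree R \<ge> 1" and A: "A \<in> carrier PGL2" and B: "B \<in> carrier PGL2"
  shows "rat_class (rat_comp B (rat_comp R A)) \<subseteq> rat_class R"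
proof
  fix T assume "T \<in> rat_class (rat_comp B (rat_comp R A))"
  then obtain C D where CD: "C \<in> carrier PGL2" "D \<in> carrier PGL2"
    and T: "T = rat_comp D (rat_comp (rat_comp B (rat_comp R A)) C)" by (auto simp: rat_class_def)
  have closed: "rat_comp A C \<in> carrier PGL2" "rat_comp D B \<in> carrier PGL2"
    using group.is_monoid[OF group_PGL2] monoid.m_closed A B CD by (metis PGL2_simps(2))+
  have nc: "nonconst A" "nonconst B" "nonconst C"
    using A B CD by (simp_all add: nonconst_if_rat_degree)
  have nc2: "nonconst (rat_comp R A)" "nonconst (rat_comp R (rat_comp A C))"
    using R A closed(1) by (simp_all add: nonconst_if_rat_degree rat_degree_rat_comp_right)
  have "T = rat_comp (rat_comp D B) (rat_comp R (rat_comp A C))"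
    unfolding T using nc nc2 by (simp add: rat_comp_assoc)
  then show "T \<in> rat_class R" using closed unfolding rat_class_def by blast
qed

lemma rat_class_rat_comp:
  fixes R :: "'a::field poly fract"
  assumes R: "rat_degree R \<ge> 1" and A: "A \<in> carrier PGL2" and B: "B \<in> carrier PGL2"
  shows "rat_class (rat_comp B (rat_comp R A)) = rat_class R"
proof -
  interpret group "PGL2 :: 'a poly fract monoid" by (rule group_PGL2)
  let ?T = "rat_comp B (rat_comp R A)"
  have nc: "nonconst A" "nonconst B" "nonconst (inv\<^bsub>PGL2\<^esub> A)" "nonconst R" "nonconst (rat_comp R A)"
    using A B R inv_closed[OF A] by (simp_all add: nonconst_if_rat_degree rat_degree_rat_comp_right)
  have d: "rat_degree ?T \<ge> 1" using A B R by (simp add: rat_degree_rat_comp_left rat_degree_rat_comp_right)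
  have "R = rat_comp (inv\<^bsub>PGL2\<^esub> B) (rat_comp ?T (inv\<^bsub>PGL2\<^esub> A))"
  proof -
    have "rat_comp (inv\<^bsub>PGL2\<^esub> B) (rat_comp ?T (inv\<^bsub>PGL2\<^esub> A)) =
        rat_comp (rat_comp (inv\<^bsub>PGL2\<^esub> B) B) (rat_comp R (rat_comp A (inv\<^bsub>PGL2\<^esub> A)))"
      using nc r_inv[OF A] by (simp add: rat_comp_assoc rat_comp_X_right)
    then show ?thesis using r_inv[OF A] l_inv[OF B] nc by (simp add: rat_comp_X_right rat_comp_X_left)
  qed
  then have "rat_class R \<subseteq> rat_class ?T"
    using rat_class_rat_comp_subset[OF d inv_closed[OF A] inv_closed[OF B]] by simp
  with rat_class_rat_comp_subset[OF R A B] show ?thesis by blast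
qed

lemma orbits_eq_rat_class:
  "orbits (PGL2 \<times>\<times> PGL2) E rat_action = rat_class ` E"
  by (simp add: orbits_def orbit_eq_rat_class Setcompr_eq_image)

section \<open>Cubic pairs of polynomials and their coordinate changes\<close>

definition cubic :: "'a::field poly \<Rightarrow> 'a poly \<Rightarrow> bool" where
  "cubic g h \<longleftrightarrow> h \<noteq> 0 \<and> degree g \<le> 3 \<and> degree h \<le> 3 \<and> rat_degree (Fract g h) = 3"

abbreviation pair_class :: "'a::field poly \<Rightarrow> 'a poly \<Rightarrow> 'a poly fract set" where
  "pair_class g h \<equiv> rat_class (Fract g h)"

text \<open>A common factor, or a drop of both degrees, would push the degree of the fraction below
  three.\<close>

lemma cubicD:
  assumes "cubic g h"
  shows "coprime g h" "max (degree g) (degree h) = 3" "h \<noteq> 0" "degree g \<le> 3" "degree h \<le> 3"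
proof -
  show h: "h \<noteq> 0" and d: "degree g \<le> 3" "degree h \<le> 3" using assms by (auto simp: cubic_def)
  have r: "rat_degree (Fract g h) = 3" using assms by (simp add: cubic_def)
  then show m: "max (degree g) (degree h) = 3" using rat_degree_Fract_le(1)[OF h, of g] d by simp
  show "coprime g h" using rat_degree_Fract_le(2)[OF h, of g] r m by simp
qed

lemma rat_degree_3E:
  assumes "rat_degree R = 3"
  obtains g h where "cubic g h" "R = Fract g h"
proof -
  obtain g h where r: "reduced_form R g h" using exists_reduced_form by blast
  then have "max (degree g) (degree h) = 3" using rat_degree_eq[OF r] assms by simp
  then have "degree g \<le> 3" "degree h \<le> 3" by linarith+
  then show ?thesis using that[of g h] r assms by (auto simp: reduced_form_def cubic_def)
qed

lemma cubic_left:
  fixes g h :: "'a::field poly"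
  assumes c: "cubic g h" and det: "a * d - b * c \<noteq> 0"
  shows "cubic (smult a g + smult b h) (smult c g + smult d h)"
    and "pair_class (smult a g + smult b h) (smult c g + smult d h) = pair_class g h"
proof -
  have r: "rat_degree (Fract g h) = 3" and h: "h \<noteq> 0" using c by (auto simp: cubic_def)
  then have nc: "nonconst (Fract g h)" by (simp add: nonconst_if_rat_degree)
  note e = rat_comp_mob_left[OF det nc h]
  have M: "mob a b c d \<in> carrier PGL2" and X: "rat_X \<in> carrier (PGL2 :: 'a poly fract monoid)"
    using det by (simp_all add: rat_degree_mob rat_X_mob)
  have d3: "degree (smult x g + smult y h) \<le> 3" for x y
    using cubicD(4,5)[OF c] by (meson degree_add_le degree_smult_le order_trans)
  then show "cubic (smult a g + smult b h) (smult c g + smult d h)"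
    unfolding cubic_def e(2)[symmetric] using e(1) rat_degree_rat_comp_left[OF M, of "Fract g h"] r by simp
  show "pair_class (smult a g + smult b h) (smult c g + smult d h) = pair_class g h"
    using rat_class_rat_comp[OF _ X M, of "Fract g h"] r by (simp add: rat_comp_X_right e(2))
qed

lemma cubic_right:
  fixes g h :: "'a::field poly"
  assumes c: "cubic g h" and det: "a * d - b * c \<noteq> 0"
  shows "cubic (homogenize 3 g [:b, a:] [:d, c:]) (homogenize 3 h [:b, a:] [:d, c:])"
    and "pair_class (homogenize 3 g [:b, a:] [:d, c:]) (homogenize 3 h [:b, a:] [:d, c:]) = pair_class g h"
proof -
  have r: "rat_degree (Fract g h) = 3" and h: "h \<noteq> 0" using c by (auto simp: cubic_def)
  then have nc: "nonconst (Fract g h)" by (simp add: nonconst_if_rat_degree)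
  note e = rat_comp_mob_right[OF det h cubicD(4,5)[OF c]]
  have M: "mob a b c d \<in> carrier PGL2" and X: "rat_X \<in> carrier (PGL2 :: 'a poly fract monoid)"
    using det by (simp_all add: rat_degree_mob rat_X_mob)
  show "cubic (homogenize 3 g [:b, a:] [:d, c:]) (homogenize 3 h [:b, a:] [:d, c:])"
    unfolding cubic_def e(2)[symmetric]
    using e(1) rat_degree_rat_comp_right[OF M, of "Fract g h"] r by (simp add: degree_homogenize_le)
  have "nonconst (rat_comp (Fract g h) (mob a b c d))"
    using rat_degree_rat_comp_right[OF M, of "Fract g h"] r by (simp add: nonconst_if_rat_degree)
  then show "pair_class (homogenize 3 g [:b, a:] [:d, c:]) (homogenize 3 h [:b, a:] [:d, c:]) = pair_class g h"
    using rat_class_rat_comp[OF _ M X, of "Fract g h"] r by (simp add: rat_comp_X_left e(2))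
qed

section \<open>Rational ramification points\<close>

lemma homogenize_3:
  "homogenize 3 p A D = smult (coeff p 0) (D ^ 3) + smult (coeff p 1) (A * D ^ 2) +
    smult (coeff p 2) (A ^ 2 * D) + smult (coeff p 3) (A ^ 3)"
proof -
  have "{..3::nat} = {0, 1, 2, 3}" by auto
  then show ?thesis by (simp add: homogenize_def numeral_eq_Suc)
qed

lemma homogenize_cubic:
  "homogenize 3 [:p0, p1, p2, p3:] A D =
    smult p0 (D ^ 3) + smult p1 (A * D ^ 2) + smult p2 (A ^ 2 * D) + smult p3 (A ^ 3)"
  "homogenize 3 [:p0, p1:] A D = smult p0 (D ^ 3) + smult p1 (A * D ^ 2)"
  "homogenize 3 1 A D = D ^ 3"
  unfolding homogenize_3 by (simp_all add: numeral_eq_Suc)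

lemma degree_le_3_imp:
  "degree p \<le> 3 \<Longrightarrow> p = [:coeff p 0, coeff p 1, coeff p 2, coeff p 3:]"
  by (rule poly_eqI) (auto simp: coeff_pCons coeff_eq_0 numeral_eq_Suc split: nat.split)

text \<open>The new pair is left free so that the simplifier can match concrete coefficients.
  Explicit instantiations list the matrix entries in the order \<open>a\<close>, \<open>d\<close>,
  \<open>b\<close>, \<open>c\<close> of their occurrence in the determinant.\<close>

lemma cubic_leftI:
  assumes "cubic g h" "a * d - b * c \<noteq> 0"
    and "g' = smult a g + smult b h" "h' = smult c g + smult d h"
  shows "cubic g' h' \<and> pair_class g' h' = pair_class g h"
  using cubic_left[OF assms(1,2)] assms(3,4) by simp

lemma cubic_affineI:
  assumes "cubic g h" "a \<noteq> 0"
    and "g' = homogenize 3 g [:b, a:] 1" "h' = homogenize 3 h [:b, a:] 1"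
  shows "cubic g' h' \<and> pair_class g' h' = pair_class g h"
  using cubic_right[OF assms(1), of a 1 b 0] assms(2-4) by (simp add: one_pCons)

lemma cubic_common_root:
  assumes "cubic g h" "poly g r = 0" "poly h r = 0"
  shows False
proof -
  have "[:-r, 1:] dvd g" "[:-r, 1:] dvd h" using assms by (simp_all add: poly_eq_0_iff_dvd)
  then have "is_unit [:-r, 1:]" using cubicD(1)[OF assms(1)] coprime_common_divisor by blast
  then show False by (simp add: is_unit_iff_degree)
qed

text \<open>Kept apart from equality of classes because the variable is not changed: ramification
  points stay where they are under this relation.\<close>

definition left_equiv :: "'a::field poly \<Rightarrow> 'a poly \<Rightarrow> 'a poly \<Rightarrow> 'a poly \<Rightarrow> bool" where
  "left_equiv g h g' h' \<longleftrightarrow> (\<exists>a b c d. a * d - b * c \<noteq> 0 \<and>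
    g' = smult a g + smult b h \<and> h' = smult c g + smult d h)"

lemma left_equivI:
  "a * d - b * c \<noteq> 0 \<Longrightarrow> g' = smult a g + smult b h \<Longrightarrow> h' = smult c g + smult d h \<Longrightarrow>
    left_equiv g h g' h'"
  unfolding left_equiv_def by blast

lemma left_equiv_refl: "left_equiv g h g h"
  by (rule left_equivI[of 1 1 0 0]) simp_all

lemma left_equiv_trans:
  assumes "left_equiv g h g' h'" "left_equiv g' h' g'' h''"
  shows "left_equiv g h g'' h''"
proof -
  obtain a b c d a' b' c' d' where 1: "a * d - b * c \<noteq> 0"
      "g' = smult a g + smult b h" "h' = smult c g + smult d h"
    and 2: "a' * d' - b' * c' \<noteq> 0" "g'' = smult a' g' + smult b' h'" "h'' = smult c' g' + smult d' h'"
    using assms unfolding left_equiv_def by blast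
  have "(a' * a + b' * c) * (c' * b + d' * d) - (a' * b + b' * d) * (c' * a + d' * c) =
      (a' * d' - b' * c') * (a * d - b * c)" by (simp add: algebra_simps)
  also have "\<dots> \<noteq> 0" using 1(1) 2(1) by simp
  finally show ?thesis
    by (rule left_equivI) (simp_all add: 1 2 smult_add_right smult_add_left)
qed

lemma cubic_left_equiv:
  assumes "cubic g h" "left_equiv g h g' h'"
  shows "cubic g' h'" "pair_class g' h' = pair_class g h"
  using assms cubic_leftI unfolding left_equiv_def by blast+

lemma cubic_normalize_denominator:
  fixes g h :: "'a::field poly"
  obtains g' h' where "left_equiv g h g' h'" "coeff h' 3 = 0"
proof (cases "coeff h 3 = 0")
  case True
  then show ?thesis using left_equiv_refl that by blast
next
  case False
  \<comment> \<open>The old denominator becomes the numerator, and a multiple of it removes the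
    cubic term of \<open>g\<close>.\<close>
  have "left_equiv g h h (smult 1 g + smult (- coeff g 3 / coeff h 3) h)"
    by (rule left_equivI[of 0 "- coeff g 3 / coeff h 3" 1 1]) simp_all
  moreover have "coeff (smult 1 g + smult (- coeff g 3 / coeff h 3) h) 3 = 0"
    using False by simp
  ultimately show ?thesis using that by blast
qed

lemma cubic_lead_coeff:
  assumes "cubic [:g0, g1, g2, g3:] [:h0, h1, h2:]"
  shows "g3 \<noteq> 0"
proof
  assume "g3 = 0"
  then have "degree [:g0, g1, g2, g3:] \<le> 2" "degree [:h0, h1, h2:] \<le> 2" by simp_all
  then show False using cubicD(2)[OF assms] by simp
qed

text \<open>Normal forms for ramification at infinity. The first family has a triple pole there; the
  other two have a double pole there and a simple pole at \<open>0\<close>.\<close>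

definition rational_ram_classes :: "'a::field poly fract set set" where
  "rational_ram_classes =
    {pair_class [:0, p, 0, 1:] 1 | p. cubic [:0, p, 0, 1:] 1} \<union>
    {pair_class [:d, 0, 1, 1:] [:0, 1:] | d. d \<noteq> 0} \<union>
    {pair_class [:d, 0, 0, 1:] [:0, 1:] | d. d \<noteq> 0}"

lemma rational_ram_classes_if_polynomial:
  fixes g0 :: "'a::field"
  assumes three: "(3::'a) \<noteq> 0" and c: "cubic [:g0, g1, g2, g3:] [:h0:]"
  shows "pair_class [:g0, g1, g2, g3:] [:h0:] \<in> rational_ram_classes"
proof -
  have g3: "g3 \<noteq> 0" using cubic_lead_coeff[of g0 g1 g2 g3 h0 0 0] c by simp
  have h0: "h0 \<noteq> 0" using cubicD(3)[OF c] by simp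
  define u v where "u = g1 / g3" and "v = g2 / g3"
  have 1: "cubic [:0, u, v, 1:] 1 \<and> pair_class [:0, u, v, 1:] 1 = pair_class [:g0, g1, g2, g3:] [:h0:]"
    by (rule cubic_leftI[OF c, of "1 / g3" "1 / h0" "- g0 / (g3 * h0)" 0])
       (use g3 h0 in \<open>simp_all add: u_def v_def one_pCons field_simps\<close>)
  \<comment> \<open>This translation removes the quadratic term, as in passing to a depressed
    cubic.\<close>
  define b where "b = - v / 3"
  define p q where "p = 3 * b^2 + 2 * v * b + u" and "q = b^3 + v * b^2 + u * b"
  have v: "v = - 3 * b" using three by (simp add: b_def)
  have 2: "cubic [:q, p, 0, 1:] 1 \<and> pair_class [:q, p, 0, 1:] 1 = pair_class [:0, u, v, 1:] 1"
    by (rule cubic_affineI[OF conjunct1[OF 1], of 1 _ b])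
       (simp_all add: homogenize_cubic p_def q_def v power3_eq_cube power2_eq_square algebra_simps)
  have 3: "cubic [:0, p, 0, 1:] 1 \<and> pair_class [:0, p, 0, 1:] 1 = pair_class [:q, p, 0, 1:] 1"
    by (rule cubic_leftI[OF conjunct1[OF 2], of 1 1 "- q" 0]) (simp_all add: one_pCons)
  have "pair_class [:g0, g1, g2, g3:] [:h0:] = pair_class [:0, p, 0, 1:] 1"
    using 1 2 3 by (simp only:)
  then show ?thesis using conjunct1[OF 3] unfolding rational_ram_classes_def by blast
qed

text \<open>The simple pole is moved to \<open>0\<close>, and a multiple of the denominator removes
  the linear term of the numerator. The constant term is nonzero because the pair has no common
  root.\<close>

lemma rational_ram_classes_if_linear_denominator:
  fixes g0 :: "'a::field"
  assumes three: "(3::'a) \<noteq> 0" and c: "cubic [:g0, g1, g2, g3:] [:h0, h1:]"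
  shows "pair_class [:g0, g1, g2, g3:] [:h0, h1:] \<in> rational_ram_classes"
proof (cases "h1 = 0")
  case True
  then show ?thesis using rational_ram_classes_if_polynomial[OF three, of g0 g1 g2 g3 h0] c by simp
next
  case h1: False
  have g3: "g3 \<noteq> 0" using cubic_lead_coeff[of g0 g1 g2 g3 h0 h1 0] c by simp
  have 1: "cubic [:g0 / g3, g1 / g3, g2 / g3, 1:] [:h0 / h1, 1:] \<and>
      pair_class [:g0 / g3, g1 / g3, g2 / g3, 1:] [:h0 / h1, 1:] = pair_class [:g0, g1, g2, g3:] [:h0, h1:]"
    by (rule cubic_leftI[OF c, of "1 / g3" "1 / h1" 0 0]) (use g3 h1 in simp_all)
  define k where "k = h0 / h1"
  define e where "e = homogenize 3 [:g0 / g3, g1 / g3, g2 / g3, 1:] [:- k, 1:] 1"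
  have 2: "cubic e [:0, 1:] \<and> pair_class e [:0, 1:] = pair_class [:g0 / g3, g1 / g3, g2 / g3, 1:] [:h0 / h1, 1:]"
    by (rule cubic_affineI[OF conjunct1[OF 1], of 1 _ "- k"]) (simp_all add: e_def homogenize_cubic k_def)
  have e3: "coeff e 3 = 1"
    unfolding e_def homogenize_cubic by (simp add: power2_eq_square numeral_3_eq_3)
  have "degree e \<le> 3" using 2 cubicD(4) by blast
  then obtain e0 e1 e2 where e: "e = [:e0, e1, e2, 1:]" using degree_le_3_imp[of e] e3 by auto
  have 3: "cubic [:e0, 0, e2, 1:] [:0, 1:] \<and> pair_class [:e0, 0, e2, 1:] [:0, 1:] = pair_class e [:0, 1:]"
    by (rule cubic_leftI[OF conjunct1[OF 2], of 1 1 "- e1" 0]) (simp_all add: e)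
  have e0: "e0 \<noteq> 0"
    using cubic_common_root[of "[:e0, 0, e2, 1:]" "[:0, 1:]" 0] 3 by auto
  show ?thesis
  proof (cases "e2 = 0")
    case True
    have "pair_class [:g0, g1, g2, g3:] [:h0, h1:] = pair_class [:e0, 0, 0, 1:] [:0, 1:]"
      using 1 2 3 True by (simp only:)
    then show ?thesis using e0 unfolding rational_ram_classes_def by blast
  next
    case False
    \<comment> \<open>Scaling the variable by \<open>e2\<close> makes the quadratic and the cubic
      coefficient equal; dividing by them leaves one parameter.\<close>
    have 4: "cubic [:e0, 0, e2^3, e2^3:] [:0, e2:] \<and>
        pair_class [:e0, 0, e2^3, e2^3:] [:0, e2:] = pair_class [:e0, 0, e2, 1:] [:0, 1:]"
      by (rule cubic_affineI[OF conjunct1[OF 3], of e2 _ 0])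
         (use False in \<open>simp_all add: homogenize_cubic power3_eq_cube power2_eq_square\<close>)
    have 5: "cubic [:e0 / e2^3, 0, 1, 1:] [:0, 1:] \<and>
        pair_class [:e0 / e2^3, 0, 1, 1:] [:0, 1:] = pair_class [:e0, 0, e2^3, e2^3:] [:0, e2:]"
      by (rule cubic_leftI[OF conjunct1[OF 4], of "1 / e2^3" "1 / e2" 0 0]) (use False in simp_all)
    have "e0 / e2^3 \<noteq> 0" using e0 False by simp
    moreover have "pair_class [:g0, g1, g2, g3:] [:h0, h1:] = pair_class [:e0 / e2^3, 0, 1, 1:] [:0, 1:]"
      using 1 2 3 4 5 by (simp only:)
    ultimately show ?thesis unfolding rational_ram_classes_def by blast
  qed
qed

text \<open>The pencil member with the double root is taken as the denominator. Moving
  \<open>r\<close> to infinity then lowers its degree to at most one.\<close>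

lemma rational_ram_classes_if_double_root:
  fixes g h :: "'a::field poly"
  assumes three: "(3::'a) \<noteq> 0" and c: "cubic g h" and st: "s \<noteq> 0 \<or> t \<noteq> 0"
    and dvd: "[:-r, 1:]^2 dvd smult s g + smult t h"
  shows "pair_class g h \<in> rational_ram_classes"
proof -
  \<comment> \<open>The vector \<open>(s, t)\<close> is completed to an invertible matrix with
    second row \<open>(s, t)\<close>.\<close>
  obtain a b where ab: "a * t - b * s \<noteq> 0"
    using st by (metis diff_0 diff_zero mult_1 mult_zero_left neg_equal_0_iff_equal)
  define g' h' where "g' = smult a g + smult b h" and "h' = smult s g + smult t h"
  have 1: "cubic g' h' \<and> pair_class g' h' = pair_class g h"
    by (rule cubic_leftI[OF c ab g'_def h'_def])
  obtain l where l: "h' = [:-r, 1:]^2 * l" using dvd h'_def by blast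
  have "l \<noteq> 0" using l cubicD(3)[OF conjunct1[OF 1]] by auto
  then have "degree h' = 2 + degree l" unfolding l by (simp add: degree_mult_eq degree_power_eq)
  then have "degree l \<le> 1" using cubicD(5)[OF conjunct1[OF 1]] by simp
  then obtain v u where vu: "l = [:v, u:]" using degree_le_1_imp by blast
  \<comment> \<open>The substitution is \<open>r + 1 / x\<close>, which sends infinity to
    \<open>r\<close>.\<close>
  define g2 where "g2 = homogenize 3 g' [:1, r:] [:0, 1:]"
  define h2 where "h2 = homogenize 3 h' [:1, r:] [:0, 1:]"
  have 2: "cubic g2 h2 \<and> pair_class g2 h2 = pair_class g' h'"
    using cubic_right[OF conjunct1[OF 1], of r 0 1 1] by (simp add: g2_def h2_def)
  have h2: "h2 = [:u, u * r + v:]"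
    by (simp add: h2_def homogenize_cubic l vu power3_eq_cube power2_eq_square algebra_simps)
  have "degree g2 \<le> 3" using 2 cubicD(4) by blast
  then obtain e0 e1 e2 e3 where "g2 = [:e0, e1, e2, e3:]" using degree_le_3_imp by blast
  then show ?thesis using rational_ram_classes_if_linear_denominator[OF three, of e0 e1 e2 e3 u "u * r + v"] 1 2 h2
    by simp
qed

lemma double_root_dvd:
  fixes p :: "'a::field poly"
  assumes "poly p a = 0" "poly (pderiv p) a = 0"
  shows "[:-a, 1:]^2 dvd p"
proof -
  obtain q where q: "p = [:-a, 1:] * q" using assms(1) by (auto simp: poly_eq_0_iff_dvd)
  have "poly (pderiv p) a = poly q a"
    unfolding q pderiv_mult poly_add poly_mult by (simp add: pderiv_pCons)
  then have "poly q a = 0" using assms(2) by simp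
  then have "[:-a, 1:] dvd q" by (simp add: poly_eq_0_iff_dvd)
  then show ?thesis unfolding q power2_eq_square by (intro mult_dvd_mono) auto
qed

lemma double_root_dvdD:
  fixes p :: "'a::field poly"
  assumes "[:-a, 1:]^2 dvd p"
  shows "poly p a = 0" "poly (pderiv p) a = 0"
proof -
  obtain q where "p = [:-a, 1:]^2 * q" using assms by (rule dvdE)
  then have q: "p = [:-a, 1:] * ([:-a, 1:] * q)" by (simp only: power2_eq_square mult.assoc)
  show "poly p a = 0" "poly (pderiv p) a = 0"
    unfolding q pderiv_mult poly_add poly_mult by simp_all
qed

text \<open>The Wronskian of the numerator and the denominator in the normal form
  \<open>(x\<^sup>3 + g1 x + g0) / (x\<^sup>2 + h1 x + h0)\<close>; its roots are the ramification points.\<close>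

definition wronskian :: "'a::field \<Rightarrow> 'a \<Rightarrow> 'a \<Rightarrow> 'a \<Rightarrow> 'a poly" where
  "wronskian g0 g1 h0 h1 = [:g1 * h0 - g0 * h1, - 2 * g0, 3 * h0 - g1, 2 * h1, 1:]"

lemma poly_wronskian:
  "poly (wronskian g0 g1 h0 h1) r =
    poly (pderiv [:g0, g1, 0, 1:]) r * poly [:h0, h1, 1:] r - poly [:g0, g1, 0, 1:] r * poly (pderiv [:h0, h1, 1:]) r"
  by (simp add: wronskian_def pderiv_pCons algebra_simps)

text \<open>The two weights make the combination vanish at \<open>r\<close>; its derivative at
  \<open>r\<close> is then the value of the Wronskian.\<close>

lemma wronskian_root_dvd:
  assumes "poly (wronskian g0 g1 h0 h1) r = 0"
  shows "[:-r, 1:]^2 dvd smult (poly [:h0, h1, 1:] r) [:g0, g1, 0, 1:] + smult (- poly [:g0, g1, 0, 1:] r) [:h0, h1, 1:]"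
  using assms unfolding poly_wronskian
  by (intro double_root_dvd) (simp_all only: poly_add poly_smult pderiv_add pderiv_smult, simp_all add: algebra_simps)

text \<open>A denominator of degree below two would ramify at infinity, so a multiple of it can
  remove the quadratic term of the numerator. A rational root of the Wronskian would give a pencil
  member with a rational double root. Both are excluded by \<open>nr\<close>.\<close>

lemma cubic_normal_form:
  fixes g h :: "'a::field poly"
  assumes three: "(3::'a) \<noteq> 0" and c: "cubic g h" and nr: "pair_class g h \<notin> rational_ram_classes"
  obtains g0 g1 h0 h1 where "left_equiv g h [:g0, g1, 0, 1:] [:h0, h1, 1:]"
    "\<forall>r. poly (wronskian g0 g1 h0 h1) r \<noteq> 0"
proof -
  obtain g' h' where le: "left_equiv g h g' h'" and c3: "coeff h' 3 = 0"
    by (rule cubic_normalize_denominator)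
  then have 1: "cubic g' h'" "pair_class g' h' = pair_class g h" "coeff h' 3 = 0"
    using cubic_left_equiv[OF c] by auto
  obtain a0 a1 a2 a3 b0 b1 b2 where g': "g' = [:a0, a1, a2, a3:]" and h': "h' = [:b0, b1, b2:]"
    using degree_le_3_imp[OF cubicD(4)[OF 1(1)]] degree_le_3_imp[OF cubicD(5)[OF 1(1)]] 1(3)
    by (metis pCons_0_0)
  have a3: "a3 \<noteq> 0" using cubic_lead_coeff 1(1) g' h' by blast
  have b2: "b2 \<noteq> 0"
  proof
    assume "b2 = 0"
    then show False using rational_ram_classes_if_linear_denominator[OF three, of a0 a1 a2 a3 b0 b1] 1 g' h' nr
      by simp
  qed
  define k where "k = a2 / (a3 * b2)"
  define g0 g1 h0 h1 where "g0 = a0 / a3 - k * b0" "g1 = a1 / a3 - k * b1" "h0 = b0 / b2" "h1 = b1 / b2"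
  note defs = this
  have le2: "left_equiv g' h' [:g0, g1, 0, 1:] [:h0, h1, 1:]"
    by (rule left_equivI[of "1 / a3" "1 / b2" "- k" 0])
       (use a3 b2 in \<open>simp_all add: g' h' defs k_def\<close>)
  note 2 = cubic_left_equiv[OF 1(1) le2]
  have "poly (wronskian g0 g1 h0 h1) r \<noteq> 0" for r
  proof
    assume z: "poly (wronskian g0 g1 h0 h1) r = 0"
    have "poly [:h0, h1, 1:] r \<noteq> 0 \<or> - poly [:g0, g1, 0, 1:] r \<noteq> 0"
      using cubic_common_root[OF 2(1), of r] by (metis neg_equal_0_iff_equal)
    from rational_ram_classes_if_double_root[OF three 2(1) this wronskian_root_dvd[OF z]]
    show False using 1 2 nr by simp
  qed
  then show ?thesis using that left_equiv_trans[OF le le2] by blast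
qed

section \<open>The Frobenius map and irrational ramification points\<close>

text \<open>Stated for a general \<open>f\<close> since it serves both the embedding
  \<open>to_ac\<close> and the square of the Frobenius map.\<close>

lemma map_poly_hom:
  fixes f :: "'a::comm_ring_1 \<Rightarrow> 'b::comm_ring_1"
  assumes f0: "f 0 = 0" and add: "\<And>x y. f (x + y) = f x + f y" and mult: "\<And>x y. f (x * y) = f x * f y"
  shows "map_poly f (p + q) = map_poly f p + map_poly f q"
    and "map_poly f (p * q) = map_poly f p * map_poly f q"
    and "map_poly f (smult c p) = smult (f c) (map_poly f p)"
proof -
  have s: "f (sum h A) = (\<Sum>x\<in>A. f (h x))" for h and A :: "nat set"
    by (induction A rule: infinite_finite_induct) (simp_all add: f0 add)
  show "map_poly f (p + q) = map_poly f p + map_poly f q"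
    by (rule poly_eqI) (simp add: coeff_map_poly f0 add)
  show "map_poly f (p * q) = map_poly f p * map_poly f q"
    by (rule poly_eqI) (simp add: coeff_map_poly f0 coeff_mult s mult)
  show "map_poly f (smult c p) = smult (f c) (map_poly f p)"
    by (rule poly_eqI) (simp add: coeff_map_poly f0 mult)
qed

section \<open>Passage to the algebraic closure\<close>

abbreviation ac_poly :: "'a::field poly \<Rightarrow> 'a alg_closure poly" where
  "ac_poly \<equiv> map_poly to_ac"

lemmas ac_poly_hom = map_poly_hom[of to_ac, OF to_ac_0 to_ac_add to_ac_mult]

lemma ac_poly_pCons [simp]: "ac_poly (pCons a p) = pCons (to_ac a) (ac_poly p)"
  by (cases "a = 0 \<and> p = 0") (auto simp: map_poly_pCons)

lemma ac_poly_1 [simp]: "ac_poly 1 = 1"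
  by (simp add: one_pCons)

lemma ac_poly_power: "ac_poly (p ^ n) = ac_poly p ^ n"
  by (induction n) (simp_all add: ac_poly_hom)

lemma poly_ac_poly_to_ac: "poly (ac_poly p) (to_ac x) = to_ac (poly p x)"
  by (induction p) simp_all

lemma ac_poly_eq_0_iff [simp]: "ac_poly p = 0 \<longleftrightarrow> p = 0"
  by (auto simp: poly_eq_iff coeff_map_poly)

lemma degree_ac_poly [simp]: "degree (ac_poly p) = degree p"
  by (rule degree_map_poly) simp

lemma pderiv_ac_poly: "pderiv (ac_poly p) = ac_poly (pderiv p)"
  by (rule poly_eqI) (simp add: coeff_pderiv coeff_map_poly)

section \<open>The Frobenius map and its fixed points\<close>

definition frob :: "'a::finite_field alg_closure \<Rightarrow> 'a alg_closure" where
  "frob x = x ^ card (UNIV :: 'a set)"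

lemma card_field_ge_2: "card (UNIV :: 'a::finite_field set) \<ge> 2"
  using card_mono[of "UNIV :: 'a set" "{0, 1}"] by simp

lemma frob_0 [simp]: "frob 0 = (0 :: 'a::finite_field alg_closure)"
  using card_field_ge_2[where 'a = 'a] by (simp add: frob_def)

lemma frob_1 [simp]: "frob 1 = 1"
  by (simp add: frob_def)

lemma frob_mult [simp]: "frob (x * y) = frob x * frob y"
  by (simp add: frob_def power_mult_distrib)

lemma frob_to_ac [simp]: "frob (to_ac x) = to_ac x"
  by (simp add: frob_def finite_field_power_card_eq_same flip: to_ac_power)

text \<open>\<open>(x + 1)\<^sup>q - x\<^sup>q - 1\<close> has degree less than \<open>q\<close> and vanishes on all of the field with
  \<open>q\<close> elements.\<close>

lemma linear_power_card:
  "[:1, 1:] ^ card (UNIV :: 'a set) = monom 1 (card (UNIV :: 'a set)) + (1 :: 'a::finite_field poly)"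
proof (rule ccontr)
  let ?q = "card (UNIV :: 'a set)"
  define P :: "'a poly" where "P = [:1, 1:] ^ ?q - (monom 1 ?q + 1)"
  assume "\<not> ?thesis"
  then have P0: "P \<noteq> 0" by (simp add: P_def)
  have q: "?q \<ge> 2" by (rule card_field_ge_2)
  have "poly P x = 0" for x
    using finite_field_power_card_eq_same[of x] finite_field_power_card_eq_same[of "1 + x"]
    by (simp add: P_def poly_monom)
  then have "{x. poly P x = 0} = UNIV" by auto
  then have "?q \<le> degree P" using card_poly_roots_bound[OF P0] by simp
  moreover have "degree P < ?q"
  proof (rule degree_lessI)
    show "\<forall>k\<ge>?q. coeff P k = 0"
    proof (intro allI impI)
      fix k assume k: "k \<ge> ?q"
      show "coeff P k = 0"
      proof (cases "k = ?q")
        case True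
        then show ?thesis using q by (simp add: P_def coeff_linear_power)
      next
        case False
        with k have "degree ([:1, 1:] ^ ?q :: 'a poly) < k" by (simp add: degree_linear_power)
        then show ?thesis using q k False by (simp add: P_def coeff_eq_0)
      qed
    qed
  qed (use P0 in auto)
  ultimately show False by simp
qed

text \<open>The identity \<open>linear_power_card\<close> is carried over to the closure, evaluated
  at \<open>x / y\<close> and multiplied by \<open>frob y\<close>.\<close>

lemma frob_add [simp]: "frob (x + y) = frob x + frob (y :: 'a::finite_field alg_closure)"
proof (cases "y = 0")
  case False
  let ?q = "card (UNIV :: 'a set)"
  have "ac_poly ([:1, 1:] ^ ?q :: 'a poly) = ac_poly (monom 1 ?q + 1)"
    by (simp only: linear_power_card)
  then have "[:1, 1:] ^ ?q = monom 1 ?q + (1 :: 'a alg_closure poly)"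
    by (simp add: ac_poly_power ac_poly_hom map_poly_monom)
  then have "poly ([:1, 1:] ^ ?q) (x / y) = poly (monom 1 ?q + 1) (x / y)" by simp
  then have "(1 + x / y) ^ ?q = (x / y) ^ ?q + 1" by (simp add: poly_monom)
  then have "frob y * frob (1 + x / y) = frob y * (frob (x / y) + 1)" by (simp add: frob_def)
  also have "frob y * frob (1 + x / y) = frob (y * (1 + x / y))" by simp
  also have "y * (1 + x / y) = x + y" using False by (simp add: field_simps)
  also have "frob y * (frob (x / y) + 1) = frob (y * (x / y)) + frob y"
    by (simp only: distrib_left frob_mult mult_1_right)
  finally show ?thesis using False by simp
qed simp

lemma frob_uminus [simp]: "frob (- x) = - frob x"
  using frob_add[of x "- x"] by (simp add: eq_neg_iff_add_eq_0 add.commute del: frob_add)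

lemma frob_diff [simp]: "frob (x - y) = frob x - frob y"
  using frob_add[of x "- y"] by (simp del: frob_add)

lemma frob_power [simp]: "frob (x ^ n) = frob x ^ n"
  by (induction n) simp_all

lemma frob_eq_0_iff [simp]: "frob x = 0 \<longleftrightarrow> x = (0 :: 'a::finite_field alg_closure)"
  using card_field_ge_2[where 'a = 'a] by (auto simp: frob_def)

lemma frob_eq_iff [simp]: "frob x = frob y \<longleftrightarrow> x = y"
  using frob_eq_0_iff[of "x - y"] by (simp del: frob_eq_0_iff)

lemma frob_divide [simp]: "frob (x / y) = frob x / frob y"
proof (cases "y = 0")
  case False
  then have "frob (x / y) * frob y = frob x" by (simp flip: frob_mult)
  then show ?thesis using False by (simp add: field_simps)
qed simp

lemma card_power_fixed_le:
  assumes "n \<ge> 2"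
  shows "finite {x :: 'b::field. x ^ n = x}" "card {x :: 'b::field. x ^ n = x} \<le> n"
proof -
  define P :: "'b poly" where "P = monom 1 n - monom 1 1"
  have "coeff P n = 1" using assms by (simp add: P_def)
  then have P0: "P \<noteq> 0" by auto
  have "degree P \<le> n" unfolding P_def using assms
    by (intro degree_diff_le) (auto simp: degree_monom_eq)
  moreover have r: "{x. poly P x = 0} = {x. x ^ n = x}" by (simp add: P_def poly_monom)
  ultimately show "card {x :: 'b. x ^ n = x} \<le> n"
    using card_poly_roots_bound[OF P0] by simp
  show "finite {x :: 'b. x ^ n = x}" using poly_roots_finite[OF P0] r by simp
qed

text \<open>The equation \<open>x ^ q = x\<close> has at most \<open>q\<close> solutions, and the
  base field already supplies \<open>q\<close> of them.\<close>

lemma frob_fixed_iff: "frob x = x \<longleftrightarrow> x \<in> range (to_ac :: 'a::finite_field \<Rightarrow> 'a alg_closure)"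
proof
  assume x: "frob x = x"
  let ?S = "{x :: 'a alg_closure. x ^ card (UNIV :: 'a set) = x}"
  note S = card_power_fixed_le[OF card_field_ge_2, where 'b = "'a alg_closure"]
  have sub: "range to_ac \<subseteq> ?S" using frob_to_ac by (auto simp: frob_def)
  have "card (range (to_ac :: 'a \<Rightarrow> _)) = card (UNIV :: 'a set)"
    by (intro card_image injI) simp
  then have "card ?S \<le> card (range (to_ac :: 'a \<Rightarrow> 'a alg_closure))" using S(2) by simp
  then have "range to_ac = ?S" using card_seteq[OF S(1) sub] by simp
  then show "x \<in> range to_ac" using x by (simp add: frob_def)
qed auto

lemma poly_ac_poly_frob: "poly (ac_poly p) (frob x) = frob (poly (ac_poly p) x)"
  by (induction p) simp_all

section \<open>Irrational double roots and ramified fibres\<close>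

lemma two_double_roots:
  fixes p :: "'b::field poly"
  assumes "[:-a, 1:]^2 dvd p" "[:-b, 1:]^2 dvd p" "a \<noteq> b" "degree p \<le> 3"
  shows "p = 0"
proof (rule ccontr)
  assume p0: "p \<noteq> 0"
  obtain q where q: "p = [:-a, 1:]^2 * q" using assms(1) by (rule dvdE)
  have "poly q b = 0" using double_root_dvdD(1)[OF assms(2)] assms(3) unfolding q by simp
  then obtain r where r: "q = [:-b, 1:] * r" by (auto simp: poly_eq_0_iff_dvd)
  have p: "p = [:-b, 1:] * ([:-a, 1:]^2 * r)" unfolding q r by (simp only: mult.left_commute)
  have "poly r b = 0"
    using double_root_dvdD(2)[OF assms(2)] assms(3) unfolding p pderiv_mult[of "[:-b, 1:]"] poly_add poly_mult
    by (simp add: pderiv_pCons)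
  then obtain t where t: "r = [:-b, 1:] * t" by (auto simp: poly_eq_0_iff_dvd)
  have "t \<noteq> 0" using p0 p t by auto
  then have "degree p = 4 + degree t"
    unfolding p t by (simp add: degree_mult_eq degree_power_eq del: mult_pCons_left)
  then show False using assms(4) by simp
qed

text \<open>The Frobenius conjugate of an irrational double root is a second double root, which is
  too much for degree three.\<close>

lemma no_irrational_double_root:
  fixes p :: "'a::finite_field poly"
  assumes "[:-\<alpha>, 1:]^2 dvd ac_poly p" "\<alpha> \<notin> range to_ac" "degree p \<le> 3"
  shows "p = 0"
proof -
  have "poly (ac_poly p) (frob \<alpha>) = 0" "poly (pderiv (ac_poly p)) (frob \<alpha>) = 0"
    using double_root_dvdD[OF assms(1)] by (simp_all add: pderiv_ac_poly poly_ac_poly_frob)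
  then have "[:-frob \<alpha>, 1:]^2 dvd ac_poly p" by (rule double_root_dvd)
  moreover have "\<alpha> \<noteq> frob \<alpha>" using assms(2) frob_fixed_iff[of \<alpha>] by auto
  ultimately have "ac_poly p = 0" using two_double_roots[OF assms(1)] assms(3) by simp
  then show ?thesis by simp
qed

text \<open>\<open>ramified g h \<alpha> \<gamma>\<close> says that the fibre of \<open>g / h\<close> through \<open>\<alpha>\<close> is \<open>2 \<alpha> + \<gamma>\<close>.\<close>

definition ramified :: "'a::field poly \<Rightarrow> 'a poly \<Rightarrow> 'a alg_closure \<Rightarrow> 'a alg_closure \<Rightarrow> bool" where
  "ramified g h \<alpha> \<gamma> \<longleftrightarrow>
    (\<exists>s t. smult s (ac_poly g) + smult t (ac_poly h) = [:-\<alpha>, 1:]^2 * [:-\<gamma>, 1:])"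

lemma no_irrational_double_root_pencil:
  fixes g h :: "'a::finite_field poly"
  assumes c: "cubic g h" and \<alpha>: "\<alpha> \<notin> range to_ac" and ab: "a \<noteq> 0 \<or> b \<noteq> 0"
    and dvd: "[:-\<alpha>, 1:]^2 dvd smult (to_ac a) (ac_poly g) + smult (to_ac b) (ac_poly h)"
  shows False
proof -
  obtain u v where uv: "u * b - v * a \<noteq> 0"
    using ab by (metis diff_0 diff_zero mult_1 mult_zero_left neg_equal_0_iff_equal)
  have c': "cubic (smult u g + smult v h) (smult a g + smult b h)" by (rule cubic_left(1)[OF c uv])
  have "[:-\<alpha>, 1:]^2 dvd ac_poly (smult a g + smult b h)" using dvd by (simp only: ac_poly_hom)
  then show False using no_irrational_double_root[OF _ \<alpha> cubicD(5)[OF c']] cubicD(3)[OF c'] by simp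
qed

text \<open>If the ratio of \<open>s\<close> and \<open>t\<close> were rational, the member would be
  a multiple of one over the base field, which has no irrational double root. Writing the ratio as a
  linear relation also covers \<open>s = 0\<close> and \<open>t = 0\<close>.\<close>

lemma pencil_ratio_irrational:
  fixes g h :: "'a::finite_field poly"
  assumes c: "cubic g h" and \<alpha>: "\<alpha> \<notin> range to_ac" and ab: "a \<noteq> 0 \<or> b \<noteq> 0"
    and dvd: "[:-\<alpha>, 1:]^2 dvd smult s (ac_poly g) + smult t (ac_poly h)"
    and st: "s \<noteq> 0 \<or> t \<noteq> 0" "s * to_ac a + t * to_ac b = 0"
  shows False
proof -
  obtain k where k: "s = k * to_ac b" "t = k * to_ac (- a)"
  proof (cases "b = 0")
    case True
    then have "s = 0" using ab st by simp
    then show ?thesis using that[of "- t / to_ac a"] ab True by simp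
  next
    case False
    then show ?thesis using that[of "s / to_ac b"] st by (simp add: field_simps add_eq_0_iff2)
  qed
  have k0: "k \<noteq> 0" using k st by auto
  have "[:-\<alpha>, 1:]^2 dvd smult k (smult (to_ac b) (ac_poly g) + smult (to_ac (- a)) (ac_poly h))"
    using dvd unfolding k by (simp add: smult_add_right smult_diff_right)
  then have "[:-\<alpha>, 1:]^2 dvd smult (to_ac b) (ac_poly g) + smult (to_ac (- a)) (ac_poly h)"
    using k0 by (simp add: dvd_smult_iff)
  then show False using no_irrational_double_root_pencil[OF c \<alpha>, of b "- a"] ab by auto
qed

text \<open>Evaluating the member at a rational \<gamma> would be a linear relation between
  \<open>s\<close> and \<open>t\<close> over the base field; it is nontrivial since \<open>g\<close>
  and \<open>h\<close> have no common root.\<close>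

lemma ramified_irrational:
  fixes g h :: "'a::finite_field poly"
  assumes c: "cubic g h" and \<alpha>: "\<alpha> \<notin> range to_ac" and r: "ramified g h \<alpha> \<gamma>"
  shows "\<gamma> \<notin> range to_ac"
proof
  assume "\<gamma> \<in> range to_ac"
  then obtain r where r': "\<gamma> = to_ac r" by blast
  obtain s t where st: "smult s (ac_poly g) + smult t (ac_poly h) = [:-\<alpha>, 1:]^2 * [:-\<gamma>, 1:]"
    using r by (auto simp: ramified_def)
  have "poly ([:-\<alpha>, 1:]^2 * [:-\<gamma>, 1:]) \<gamma> = 0" by simp
  then have "poly (smult s (ac_poly g) + smult t (ac_poly h)) \<gamma> = 0" by (simp only: st)
  then have "s * to_ac (poly g r) + t * to_ac (poly h r) = 0" by (simp add: r' poly_ac_poly_to_ac)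
  moreover have "poly g r \<noteq> 0 \<or> poly h r \<noteq> 0" using cubic_common_root[OF c] by blast
  moreover have "s \<noteq> 0 \<or> t \<noteq> 0"
  proof (rule ccontr)
    assume "\<not> (s \<noteq> 0 \<or> t \<noteq> 0)"
    then have "[:-\<alpha>, 1:]^2 * [:-\<gamma>, 1:] = 0" using st by simp
    then show False by (simp del: mult_pCons_right)
  qed
  moreover have "[:-\<alpha>, 1:]^2 dvd smult s (ac_poly g) + smult t (ac_poly h)" by (simp only: st dvd_triv_left)
  ultimately show False using pencil_ratio_irrational[OF c \<alpha>] by blast
qed

lemma ramified_left:
  fixes g h :: "'a::field poly"
  assumes r: "ramified g h \<alpha> \<gamma>" and det: "a * d - b * c \<noteq> 0"
  shows "ramified (smult a g + smult b h) (smult c g + smult d h) \<alpha> \<gamma>"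
proof -
  obtain s t where st: "smult s (ac_poly g) + smult t (ac_poly h) = [:-\<alpha>, 1:]^2 * [:-\<gamma>, 1:]"
    using r by (auto simp: ramified_def)
  define e where "e = to_ac (a * d - b * c)"
  have e: "e \<noteq> 0" using det unfolding e_def by (metis to_ac_eq_0_iff)
  \<comment> \<open>The row vector \<open>(s, t)\<close> is multiplied by the inverse of the matrix
    with rows \<open>(a, b)\<close> and \<open>(c, d)\<close>.\<close>
  define s' t' where "s' = (s * to_ac d - t * to_ac c) / e" and "t' = (t * to_ac a - s * to_ac b) / e"
  have "s' * to_ac a + t' * to_ac c = s * e / e" "s' * to_ac b + t' * to_ac d = t * e / e"
    unfolding s'_def t'_def times_divide_eq_left add_divide_distrib[symmetric]
    by (simp_all add: e_def algebra_simps)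
  then have e1: "s' * to_ac a + t' * to_ac c = s" "s' * to_ac b + t' * to_ac d = t" using e by simp_all
  have "smult s' (ac_poly (smult a g + smult b h)) + smult t' (ac_poly (smult c g + smult d h))
      = smult (s' * to_ac a + t' * to_ac c) (ac_poly g) + smult (s' * to_ac b + t' * to_ac d) (ac_poly h)"
    by (simp add: ac_poly_hom smult_add_right smult_add_left)
  then show ?thesis using st e1 unfolding ramified_def by metis
qed

lemma ramified_left_equiv:
  "left_equiv g h g' h' \<Longrightarrow> ramified g h \<alpha> \<gamma> \<Longrightarrow> ramified g' h' \<alpha> \<gamma>"
  using ramified_left unfolding left_equiv_def by blast

lemma ac_poly_homogenize:
  "ac_poly (homogenize 3 p A D) = homogenize 3 (ac_poly p) (ac_poly A) (ac_poly D)"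
  by (simp add: homogenize_3 ac_poly_hom ac_poly_power coeff_map_poly)

lemma homogenize_linear:
  "smult s (homogenize 3 p A D) + smult t (homogenize 3 q A D) = homogenize 3 (smult s p + smult t q) A D"
  by (simp add: homogenize_3 smult_add_right smult_add_left algebra_simps)

lemma homogenize_double_root:
  fixes A D :: "'b::field poly"
  shows "homogenize 3 ([:-\<alpha>, 1:]^2 * [:-\<gamma>, 1:]) A D = (A - smult \<alpha> D)^2 * (A - smult \<gamma> D)"
  by (simp add: power2_eq_square homogenize_cubic)
     (simp add: power3_eq_cube algebra_simps smult_add_left smult_diff_left smult_diff_right numeral_poly)

text \<open>Roots move by the inverse of the substitution. The hypotheses \<open>nz\<close> keep the
  new roots away from infinity, so every linear factor keeps its degree.\<close>

lemma ramified_right: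
  fixes g h :: "'a::field poly"
  assumes r: "ramified g h \<alpha> \<gamma>" and nz: "to_ac a - \<alpha> * to_ac c \<noteq> 0" "to_ac a - \<gamma> * to_ac c \<noteq> 0"
  shows "ramified (homogenize 3 g [:b, a:] [:d, c:]) (homogenize 3 h [:b, a:] [:d, c:])
    ((\<alpha> * to_ac d - to_ac b) / (to_ac a - \<alpha> * to_ac c))
    ((\<gamma> * to_ac d - to_ac b) / (to_ac a - \<gamma> * to_ac c))"
proof -
  obtain s t where st: "smult s (ac_poly g) + smult t (ac_poly h) = [:-\<alpha>, 1:]^2 * [:-\<gamma>, 1:]"
    using r by (auto simp: ramified_def)
  let ?A = "[:to_ac b, to_ac a:]" and ?D = "[:to_ac d, to_ac c:]"
  let ?l = "\<lambda>\<beta>. to_ac a - \<beta> * to_ac c" and ?m = "\<lambda>\<beta>. (\<beta> * to_ac d - to_ac b) / (to_ac a - \<beta> * to_ac c)"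
  have lin: "?A - smult \<beta> ?D = smult (?l \<beta>) [:- ?m \<beta>, 1:]" if "?l \<beta> \<noteq> 0" for \<beta>
    using that by (simp add: field_simps)
  define e where "e = ?l \<alpha> ^ 2 * ?l \<gamma>"
  have e: "e \<noteq> 0" using nz by (simp add: e_def)
  have "smult s (ac_poly (homogenize 3 g [:b, a:] [:d, c:])) + smult t (ac_poly (homogenize 3 h [:b, a:] [:d, c:]))
      = homogenize 3 ([:-\<alpha>, 1:]^2 * [:-\<gamma>, 1:]) ?A ?D"
    unfolding ac_poly_homogenize homogenize_linear st by simp
  also have "\<dots> = smult (?l \<alpha>) [:- ?m \<alpha>, 1:] ^ 2 * smult (?l \<gamma>) [:- ?m \<gamma>, 1:]"
    unfolding homogenize_double_root lin[OF nz(1)] lin[OF nz(2)] ..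
  also have "\<dots> = smult e ([:- ?m \<alpha>, 1:] ^ 2 * [:- ?m \<gamma>, 1:])"
    unfolding e_def smult_power mult_smult_left mult_smult_right smult_smult
    by (simp only: mult.commute)
  finally have *: "smult s (ac_poly (homogenize 3 g [:b, a:] [:d, c:])) + smult t (ac_poly (homogenize 3 h [:b, a:] [:d, c:]))
      = smult e ([:- ?m \<alpha>, 1:] ^ 2 * [:- ?m \<gamma>, 1:])" .
  have "smult (s / e) (ac_poly (homogenize 3 g [:b, a:] [:d, c:])) + smult (t / e) (ac_poly (homogenize 3 h [:b, a:] [:d, c:]))
      = smult (inverse e) (smult s (ac_poly (homogenize 3 g [:b, a:] [:d, c:])) + smult t (ac_poly (homogenize 3 h [:b, a:] [:d, c:])))"
    by (simp add: smult_add_right divide_inverse mult.commute)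
  also have "\<dots> = [:- ?m \<alpha>, 1:] ^ 2 * [:- ?m \<gamma>, 1:]" unfolding * using e by simp
  finally show ?thesis unfolding ramified_def by blast
qed

section \<open>Double counting\<close>

lemma ac_poly_wronskian:
  "ac_poly (wronskian g0 g1 h0 h1) = wronskian (to_ac g0) (to_ac g1) (to_ac h0) (to_ac h1)"
  by (simp add: wronskian_def)

text \<open>The nonzero vector \<open>(s, t)\<close> solves the two linear equations given by the
  values and the derivatives at \<alpha>, so their determinant, the Wronskian at \<alpha>,
  vanishes.\<close>

lemma wronskian_root_if_ramified:
  assumes "ramified [:g0, g1, 0, 1:] [:h0, h1, 1:] \<alpha> \<gamma>"
  shows "poly (ac_poly (wronskian g0 g1 h0 h1)) \<alpha> = 0"
proof -
  let ?g = "ac_poly [:g0, g1, 0, 1:]" and ?h = "ac_poly [:h0, h1, 1:]"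
  obtain s t where st: "smult s ?g + smult t ?h = [:-\<alpha>, 1:]^2 * [:-\<gamma>, 1:]"
    using assms by (auto simp: ramified_def simp del: ac_poly_pCons)
  have "[:-\<alpha>, 1:]^2 dvd smult s ?g + smult t ?h" by (simp only: st dvd_triv_left)
  note D = double_root_dvdD[OF this]
  have v: "s * poly ?g \<alpha> + t * poly ?h \<alpha> = 0"
    using D(1) by (simp only: poly_add poly_smult)
  have d: "s * poly (pderiv ?g) \<alpha> + t * poly (pderiv ?h) \<alpha> = 0"
    using D(2) by (simp only: poly_add poly_smult pderiv_add pderiv_smult)
  have st0: "s \<noteq> 0 \<or> t \<noteq> 0"
  proof (rule ccontr)
    assume "\<not> (s \<noteq> 0 \<or> t \<noteq> 0)"
    then have "[:-\<alpha>, 1:]^2 * [:-\<gamma>, 1:] = 0" using st by simp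
    then show False by (simp del: mult_pCons_right)
  qed
  define w where "w = poly (pderiv ?g) \<alpha> * poly ?h \<alpha> - poly ?g \<alpha> * poly (pderiv ?h) \<alpha>"
  have "s * w = (s * poly (pderiv ?g) \<alpha> + t * poly (pderiv ?h) \<alpha>) * poly ?h \<alpha> -
      (s * poly ?g \<alpha> + t * poly ?h \<alpha>) * poly (pderiv ?h) \<alpha>"
    unfolding w_def by (simp only: algebra_simps)
  then have "s * w = 0" unfolding v d by simp
  moreover have "t * w = (s * poly ?g \<alpha> + t * poly ?h \<alpha>) * poly (pderiv ?g) \<alpha> -
      (s * poly (pderiv ?g) \<alpha> + t * poly (pderiv ?h) \<alpha>) * poly ?g \<alpha>"
    unfolding w_def by (simp only: algebra_simps)
  then have "t * w = 0" unfolding v d by simp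
  ultimately have "w = 0" using st0 by auto
  then show ?thesis unfolding ac_poly_wronskian poly_wronskian w_def by simp
qed

lemma cubic_common_root_ac:
  fixes g h :: "'a::field poly"
  assumes c: "cubic g h" and z: "poly (ac_poly g) \<alpha> = 0" "poly (ac_poly h) \<alpha> = 0"
  shows False
proof -
  obtain u v where "u * g + v * h = 1" using bezout_field_poly[OF cubicD(1)[OF c]] by blast
  then have "ac_poly (u * g + v * h) = 1" by simp
  then have "poly (ac_poly u * ac_poly g + ac_poly v * ac_poly h) \<alpha> = 1" by (simp only: ac_poly_hom poly_1)
  then show False using z by simp
qed

lemma ramified_if_wronskian_root:
  fixes g0 :: "'a::finite_field"
  assumes c: "cubic [:g0, g1, 0, 1:] [:h0, h1, 1:]" and \<alpha>: "\<alpha> \<notin> range to_ac"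
    and z: "poly (ac_poly (wronskian g0 g1 h0 h1)) \<alpha> = 0"
  obtains \<gamma> where "ramified [:g0, g1, 0, 1:] [:h0, h1, 1:] \<alpha> \<gamma>"
proof -
  let ?g = "ac_poly [:g0, g1, 0, 1:]" and ?h = "ac_poly [:h0, h1, 1:]"
  define s t where "s = poly ?h \<alpha>" and "t = - poly ?g \<alpha>"
  have dvd: "[:-\<alpha>, 1:]^2 dvd smult s ?g + smult t ?h"
    using wronskian_root_dvd[OF z[unfolded ac_poly_wronskian]] by (simp add: s_def t_def)
  have st: "s \<noteq> 0 \<or> t \<noteq> 0" using cubic_common_root_ac[OF c, of \<alpha>] unfolding s_def t_def neg_equal_0_iff_equal by blast
  \<comment> \<open>With \<open>s = 0\<close> the denominator itself would have the irrational
    double root. Hence the member has degree exactly three, and its third root is finite.\<close>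
  have s0: "s \<noteq> 0"
  proof
    assume "s = 0"
    then show False using pencil_ratio_irrational[OF c \<alpha> _ dvd st, of 1 0] by simp
  qed
  obtain l where l: "smult s ?g + smult t ?h = [:-\<alpha>, 1:]^2 * l" using dvd by (rule dvdE)
  have dP: "degree (smult s ?g + smult t ?h) = 3" "coeff (smult s ?g + smult t ?h) 3 = s"
    using s0 by (simp_all add: numeral_3_eq_3)
  then have l0: "l \<noteq> 0" unfolding l by auto
  have dl: "degree l = 1" using dP(1) l0 unfolding l by (simp add: degree_mult_eq degree_power_eq)
  have "lead_coeff (smult s ?g + smult t ?h) = lead_coeff l"
    unfolding l lead_coeff_mult lead_coeff_power by simp
  then have "coeff l 1 = s" using dP dl by simp
  then have l': "l = smult s [:- (- coeff l 0 / s), 1:]" using degree_le_1_imp[of l] dl s0 by simp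
  have "smult 1 ?g + smult (t / s) ?h = smult (1 / s) (smult s ?g + smult t ?h)"
    using s0 by (simp add: smult_add_right)
  also have "\<dots> = [:-\<alpha>, 1:]^2 * [:- (- coeff l 0 / s), 1:]"
    unfolding l by (subst l') (use s0 in \<open>simp only: mult_smult_right smult_smult, simp\<close>)
  finally show ?thesis using that unfolding ramified_def by blast
qed

text \<open>Both sides bound the number of related pairs, summed once over \<open>U\<close> and once
  over \<open>S\<close>.\<close>

lemma double_count:
  fixes P :: "'b \<Rightarrow> 'c \<Rightarrow> bool"
  assumes "finite U" "finite S"
    and "\<And>x. x \<in> U \<Longrightarrow> m \<le> card {s \<in> S. P x s}"
    and "\<And>s. s \<in> S \<Longrightarrow> card {x \<in> U. P x s} \<le> k"
  shows "m * card U \<le> k * card S"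
proof -
  have "card U * m \<le> (\<Sum>x\<in>U. card {s \<in> S. P x s})"
    using sum_mono[of U "\<lambda>_. m", OF assms(3)] by simp
  also have "\<dots> = (\<Sum>s\<in>S. card {x \<in> U. P x s})"
    by (rule sum_multicount_gen) (use assms in auto)
  also have "\<dots> \<le> (\<Sum>s\<in>S. k)" by (rule sum_mono[OF assms(4)])
  finally show ?thesis by (simp add: mult.commute)
qed

section \<open>The set of cubic classes and the bound for rational ramification\<close>

definition cubic_classes :: "'a::field poly fract set set" where
  "cubic_classes = rat_class ` {R. rat_degree R = 3}"

lemma cubic_classesI: "cubic g h \<Longrightarrow> pair_class g h \<in> cubic_classes"
  by (auto simp: cubic_classes_def cubic_def)

lemma cubic_classesE:
  assumes "C \<in> cubic_classes"
  obtains g h where "cubic g h" "C = pair_class g h"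
  using assms rat_degree_3E unfolding cubic_classes_def by (metis (mono_tags, lifting) imageE mem_Collect_eq)

lemma finite_cubic_classes: "finite (cubic_classes :: 'a::finite_field poly fract set set)"
proof -
  have "cubic_classes \<subseteq> (\<lambda>(g0 :: 'a, g1, g2, g3, h0, h1, h2, h3).
      pair_class [:g0, g1, g2, g3:] [:h0, h1, h2, h3:]) ` UNIV"
  proof
    fix C :: "'a poly fract set" assume "C \<in> cubic_classes"
    then obtain g h where "cubic g h" "C = pair_class g h" by (rule cubic_classesE)
    then have "C = (\<lambda>(g0, g1, g2, g3, h0, h1, h2, h3). pair_class [:g0, g1, g2, g3:] [:h0, h1, h2, h3:])
        (coeff g 0, coeff g 1, coeff g 2, coeff g 3, coeff h 0, coeff h 1, coeff h 2, coeff h 3)"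
      unfolding prod.case using degree_le_3_imp cubicD(4,5) by metis
    then show "C \<in> (\<lambda>(g0, g1, g2, g3, h0, h1, h2, h3).
      pair_class [:g0, g1, g2, g3:] [:h0, h1, h2, h3:]) ` UNIV" by blast
  qed
  then show ?thesis by (rule finite_subset) simp
qed

text \<open>The bound \<open>1 + (q - 1) / 2 + 2 (q - 1)\<close> is doubled and rearranged to avoid
  division and truncated subtraction.\<close>

lemma card_rational_ram_classes:
  assumes two: "(2 :: 'a::finite_field) \<noteq> 0" and three: "(3::'a) \<noteq> 0"
  shows "finite (rational_ram_classes :: 'a poly fract set set)"
    and "2 * card (rational_ram_classes :: 'a poly fract set set) + 3 \<le> 5 * card (UNIV :: 'a set)"
proof -
  let ?q = "card (UNIV :: 'a set)"
  let ?f = "\<lambda>p :: 'a. pair_class [:0, p, 0, 1:] 1"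
  define U where "U = ?f ` {p. p \<noteq> 0 \<and> cubic [:0, p, 0, 1:] 1}"
  define Y Z where "Y = (\<lambda>d :: 'a. pair_class [:d, 0, 1, 1:] [:0, 1:]) ` (UNIV - {0})"
    and "Z = (\<lambda>d :: 'a. pair_class [:d, 0, 0, 1:] [:0, 1:]) ` (UNIV - {0})"
  have sub: "rational_ram_classes \<subseteq> insert (?f 0) U \<union> Y \<union> Z"
    unfolding rational_ram_classes_def U_def Y_def Z_def by auto
  have fin: "finite U" "finite Y" "finite Z" by (simp_all add: U_def Y_def Z_def)
  then show "finite (rational_ram_classes :: 'a poly fract set set)"
    using finite_subset[OF sub] by simp
  have q1: "card (UNIV - {0 :: 'a}) = ?q - 1" by (simp add: card_Diff_singleton)
  have "(2::'a) * 2 \<noteq> 0" "(2::'a) * 2 * 2 \<noteq> 0" using two by (simp_all only: mult_eq_0_iff simp_thms)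
  then have four: "(4::'a) \<noteq> 0" and eight: "(8::'a) \<noteq> 0" by simp_all
  \<comment> \<open>Replacing \<open>x\<close> by \<open>2 x\<close> and dividing by
    \<open>8\<close> turns \<open>x^3 + p x\<close> into \<open>x^3 + (p / 4) x\<close>.\<close>
  have scale: "?f (p / 4) = ?f p" if c: "cubic [:0, p, 0, 1:] 1" for p
  proof -
    have e: "p / 4 = 2 * p / 8"
      by (simp add: frac_eq_eq four eight)
    have 1: "cubic [:0, 2 * p, 0, 8:] 1 \<and> pair_class [:0, 2 * p, 0, 8:] 1 = ?f p"
      by (rule cubic_affineI[OF c two, of _ 0]) (simp_all add: homogenize_cubic power3_eq_cube)
    have "cubic [:0, p / 4, 0, 1:] 1 \<and> pair_class [:0, p / 4, 0, 1:] 1 = pair_class [:0, 2 * p, 0, 8:] 1"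
      by (rule cubic_leftI[OF conjunct1[OF 1], of "1 / 8" 1 0 0])
         (use eight e in simp_all)
    then show ?thesis using 1 by simp
  qed
  \<comment> \<open>Each class in \<open>U\<close> has the two parameters \<open>p\<close> and
    \<open>p / 4\<close>, which are distinct because \<open>3\<close> and \<open>p\<close> are
    nonzero.\<close>
  have "2 * card U \<le> 1 * card (UNIV - {0 :: 'a})"
  proof (rule double_count[where P = "\<lambda>C p. C = ?f p"])
    fix C assume "C \<in> U"
    then obtain p where p: "p \<noteq> 0" "cubic [:0, p, 0, 1:] 1" "C = ?f p" by (auto simp: U_def)
    have "p / 4 \<noteq> p"
    proof
      assume "p / 4 = p"
      then have "p = p * 4" using four by (simp add: field_simps)
      moreover have "p * 3 = p * (4 - 1)" by simp
      then have "p * 3 = p * 4 - p" by (simp only: right_diff_distrib mult_1_right)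
      ultimately have "p * 3 = 0" by (metis diff_self)
      then show False using p(1) three mult_eq_0_iff by blast
    qed
    then have "card {p, p / 4} = 2" by (metis card_2_iff)
    moreover have "{p, p / 4} \<subseteq> {s \<in> UNIV - {0}. C = ?f s}"
      using p scale[OF p(2)] four by simp
    then have "card {p, p / 4} \<le> card {s \<in> UNIV - {0}. C = ?f s}"
      by (rule card_mono[rotated]) simp
    ultimately show "2 \<le> card {s \<in> UNIV - {0}. C = ?f s}" by (simp only:)
  next
    fix p :: 'a
    have "{C \<in> U. C = ?f p} \<subseteq> {?f p}" by blast
    then have "card {C \<in> U. C = ?f p} \<le> card {?f p}" by (rule card_mono[rotated]) simp
    then show "card {C \<in> U. C = ?f p} \<le> 1" by simp
  qed (use fin in auto)
  then have U: "2 * card U \<le> ?q - 1" using q1 by simp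
  have Y: "card Y \<le> ?q - 1" and Z: "card Z \<le> ?q - 1"
    unfolding Y_def Z_def q1[symmetric] by (rule card_image_le, simp)+
  have "card (rational_ram_classes :: 'a poly fract set set) \<le> card (insert (?f 0) U \<union> Y \<union> Z)"
    by (rule card_mono[OF _ sub]) (use fin in simp)
  also have "\<dots> \<le> card (insert (?f 0) U) + card Y + card Z"
    by (meson add_le_mono card_Un_le le_refl order_trans)
  also have "\<dots> \<le> (card U + 1) + (?q - 1) + (?q - 1)"
    using Y Z card_insert_le_m1 fin(1) by (simp add: card_insert_if)
  finally show "2 * card (rational_ram_classes :: 'a poly fract set set) + 3 \<le> 5 * ?q"
    using U card_field_ge_2[where 'a = 'a] by linarith
qed

section \<open>Ramification points of degree four\<close>

lemma poly_zero_if_many_roots: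
  fixes p :: "'b::field poly"
  assumes "A \<subseteq> {x. poly p x = 0}" "degree p < card A"
  shows "p = 0"
proof (rule ccontr)
  assume p: "p \<noteq> 0"
  have "card A \<le> card {x. poly p x = 0}"
    by (rule card_mono[OF poly_roots_finite[OF p] assms(1)])
  then show False using card_poly_roots_bound[OF p] assms(2) by linarith
qed

lemma poly_ac_poly_frob_root: "poly (ac_poly p) x = 0 \<Longrightarrow> poly (ac_poly p) (frob x) = 0"
  by (simp add: poly_ac_poly_frob)

text \<open>The conjugates \<alpha>, \<open>frob \<alpha>\<close> and
  \<open>frob (frob \<alpha>)\<close> are three distinct roots.\<close>

lemma ac_poly_zero_if_root_degree_2:
  fixes p :: "'a::finite_field poly"
  assumes "frob (frob \<alpha>) \<noteq> \<alpha>" "poly (ac_poly p) \<alpha> = 0" "degree p \<le> 2"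
  shows "p = 0"
proof -
  have n: "frob \<alpha> \<noteq> \<alpha>" using assms(1) by auto
  have "ac_poly p = 0"
  proof (rule poly_zero_if_many_roots)
    show "{\<alpha>, frob \<alpha>, frob (frob \<alpha>)} \<subseteq> {x. poly (ac_poly p) x = 0}"
      using assms(2) by (simp add: poly_ac_poly_frob_root)
    have "card {\<alpha>, frob \<alpha>, frob (frob \<alpha>)} = 3" using n assms(1) by (simp add: eq_commute)
    then show "degree (ac_poly p) < card {\<alpha>, frob \<alpha>, frob (frob \<alpha>)}" using assms(3) by simp
  qed
  then show ?thesis by simp
qed

text \<open>The elements of degree exactly four over the base field.\<close>

definition quartic_irr :: "'a::finite_field alg_closure set" where
  "quartic_irr = {\<alpha>. frob (frob \<alpha>) \<noteq> \<alpha> \<and> frob (frob (frob (frob \<alpha>))) = \<alpha>}"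

lemma ac_poly_zero_if_root_degree_3:
  fixes p :: "'a::finite_field poly"
  assumes \<alpha>: "\<alpha> \<in> quartic_irr" and r: "poly (ac_poly p) \<alpha> = 0" and d: "degree p \<le> 3"
  shows "p = 0"
proof -
  let ?A = "{\<alpha>, frob \<alpha>, frob (frob \<alpha>), frob (frob (frob \<alpha>))}"
  have n2: "frob (frob \<alpha>) \<noteq> \<alpha>" and f4: "frob (frob (frob (frob \<alpha>))) = \<alpha>"
    using \<alpha> by (auto simp: quartic_irr_def)
  have n1: "frob \<alpha> \<noteq> \<alpha>" using n2 by auto
  have n3: "frob (frob (frob \<alpha>)) \<noteq> \<alpha>" using f4 n1 by auto
  have "ac_poly p = 0"
  proof (rule poly_zero_if_many_roots)
    show "?A \<subseteq> {x. poly (ac_poly p) x = 0}" using r by (simp add: poly_ac_poly_frob_root)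
    have "card ?A = 4" using n1 n2 n3 by (simp add: eq_commute)
    then show "degree (ac_poly p) < card ?A" using d by simp
  qed
  then show ?thesis by simp
qed

lemma card_quartic_irr:
  "finite (quartic_irr :: 'a::finite_field alg_closure set)"
  "card (quartic_irr :: 'a::finite_field alg_closure set) \<le> card (UNIV :: 'a set) ^ 4"
proof -
  let ?q = "card (UNIV :: 'a set)"
  have q: "?q ^ 4 \<ge> 2"
    using power_mono[OF card_field_ge_2[where 'a = 'a], of 4] by simp
  note F = card_power_fixed_le[OF q, where 'b = "'a alg_closure"]
  have "frob (frob (frob (frob x))) = x ^ (?q ^ 4)" for x :: "'a alg_closure"
    by (simp add: frob_def numeral_eq_Suc mult.assoc flip: power_mult)
  then have sub: "(quartic_irr :: 'a alg_closure set) \<subseteq> {x. x ^ (?q ^ 4) = x}"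
    by (auto simp: quartic_irr_def)
  show "finite (quartic_irr :: 'a alg_closure set)" by (rule finite_subset[OF sub F(1)])
  show "card (quartic_irr :: 'a alg_closure set) \<le> ?q ^ 4"
    using card_mono[OF F(1) sub] F(2) by linarith
qed

text \<open>A root \<open>\<alpha>\<close> outside the quadratic extension cannot be fixed by \<open>frob\<^sup>3\<close>, since the
  remaining root would then be rational.\<close>

lemma quartic_root_in_quartic_irr:
  fixes W :: "'a::finite_field poly"
  assumes W_def: "W = [:w0, w1, w2, w3, 1:]" and r: "poly (ac_poly W) \<alpha> = 0" and nr: "\<And>x. poly W x \<noteq> 0" and n2: "frob (frob \<alpha>) \<noteq> \<alpha>"
  shows "\<alpha> \<in> quartic_irr"
proof -
  have n1: "frob \<alpha> \<noteq> \<alpha>" using n2 by auto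
  let ?a = "\<alpha>" and ?b = "frob \<alpha>" and ?c = "frob (frob \<alpha>)"
  have rb: "poly (ac_poly W) ?b = 0" and rc: "poly (ac_poly W) ?c = 0"
    using r by (simp_all add: poly_ac_poly_frob_root)
  obtain W1 where 1: "ac_poly W = [:- ?a, 1:] * W1" using r by (auto simp: poly_eq_0_iff_dvd)
  have "poly W1 ?b = 0" using rb n1 unfolding 1 by simp
  then obtain W2 where 2: "W1 = [:- ?b, 1:] * W2" by (auto simp: poly_eq_0_iff_dvd)
  have "poly W2 ?c = 0" using rc n1 n2 unfolding 1 2 by simp
  then obtain W3 where 3: "W2 = [:- ?c, 1:] * W3" by (auto simp: poly_eq_0_iff_dvd)
  have e: "ac_poly W = [:- ?a, 1:] * ([:- ?b, 1:] * ([:- ?c, 1:] * W3))" by (simp only: 1 2 3)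
  have W: "degree (ac_poly W) = 4" "lead_coeff (ac_poly W) = 1" by (simp_all add: W_def)
  have W30: "W3 \<noteq> 0" using W(1) unfolding e by auto
  then have "degree (ac_poly W) = 3 + degree W3"
    unfolding e by (simp add: degree_mult_eq del: mult_pCons_left)
  then have d3: "degree W3 = 1" using W(1) by simp
  have "lead_coeff W3 = 1" using W(2) unfolding e lead_coeff_mult by simp
  then obtain \<delta> where \<delta>: "W3 = [:- \<delta>, 1:]"
    using degree_le_1_imp[of W3] d3 by (metis minus_minus order_refl)
  have "coeff (ac_poly W) 3 = - (?a + ?b + ?c + \<delta>)"
    unfolding e \<delta> by (simp add: numeral_3_eq_3)
  then have sum: "?a + ?b + ?c + \<delta> = - to_ac w3" by (simp add: W_def numeral_3_eq_3)
  have "poly (ac_poly W) (frob ?c) = 0" using rc by (simp add: poly_ac_poly_frob_root)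
  then have "(frob ?c - ?a) * ((frob ?c - ?b) * ((frob ?c - ?c) * (frob ?c - \<delta>))) = 0"
    unfolding e \<delta> poly_mult by simp
  moreover have "frob ?c \<noteq> ?b" "frob ?c \<noteq> ?c" using n1 n2 by simp_all
  ultimately have c: "frob ?c = ?a \<or> frob ?c = \<delta>" by simp
  \<comment> \<open>The sum of the four roots is rational, hence fixed by \<open>frob\<close>. This
    determines \<open>frob \<delta>\<close> once \<open>frob ?c\<close> is known.\<close>
  have fsum: "?b + ?c + frob ?c + frob \<delta> = ?a + ?b + ?c + \<delta>"
  proof -
    have "frob (?a + ?b + ?c + \<delta>) = ?a + ?b + ?c + \<delta>" unfolding sum by simp
    then show ?thesis by simp
  qed
  have "frob ?c \<noteq> ?a"
  proof
    assume "frob ?c = ?a"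
    then have "frob \<delta> = \<delta>" using fsum by (simp add: algebra_simps)
    then obtain x where x: "\<delta> = to_ac x" using frob_fixed_iff by auto
    have "poly (ac_poly W) \<delta> = 0" unfolding e \<delta> poly_mult by simp
    then have "poly W x = 0" unfolding x poly_ac_poly_to_ac by simp
    then show False using nr by blast
  qed
  then have "frob ?c = \<delta>" using c by blast
  then have "frob (frob ?c) = ?a" using fsum by (simp add: algebra_simps)
  then show ?thesis using n2 unfolding quartic_irr_def by simp
qed

section \<open>Moebius transformations acting on the ramification points of a class\<close>

definition ramified_class :: "'a::field poly fract set \<Rightarrow> 'a alg_closure \<Rightarrow> 'a alg_closure \<Rightarrow> bool" where
  "ramified_class C \<alpha> \<gamma> \<longleftrightarrow> (\<exists>g h. cubic g h \<and> C = pair_class g h \<and> ramified g h \<alpha> \<gamma>)"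

lemma ramified_class_moebius:
  fixes C :: "'a::finite_field poly fract set"
  assumes r: "ramified_class C \<alpha> \<gamma>" and \<alpha>: "\<alpha> \<notin> range to_ac" and det: "a * d - b * c \<noteq> 0"
  shows "ramified_class C ((\<alpha> * to_ac d - to_ac b) / (to_ac a - \<alpha> * to_ac c))
    ((\<gamma> * to_ac d - to_ac b) / (to_ac a - \<gamma> * to_ac c))"
proof -
  obtain g h where gh: "cubic g h" "C = pair_class g h" "ramified g h \<alpha> \<gamma>"
    using r by (auto simp: ramified_class_def)
  have \<gamma>: "\<gamma> \<notin> range to_ac" by (rule ramified_irrational[OF gh(1) \<alpha> gh(3)])
  have nz: "to_ac a - \<beta> * to_ac c \<noteq> 0" if "\<beta> \<notin> range to_ac" for \<beta>
  proof
    assume z: "to_ac a - \<beta> * to_ac c = 0"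
    show False
    proof (cases "c = 0")
      case True
      then show False using z det by simp
    next
      case False
      then have "\<beta> = to_ac (a / c)" using z by (simp add: field_simps)
      then show False using that by blast
    qed
  qed
  show ?thesis unfolding ramified_class_def
    using cubic_right[OF gh(1) det] ramified_right[OF gh(3) nz[OF \<alpha>] nz[OF \<gamma>]] gh(2) by metis
qed

lemma quartic_irr_irrational: "\<alpha> \<in> quartic_irr \<Longrightarrow> \<alpha> \<notin> range to_ac"
  by (auto simp: quartic_irr_def)

lemma quartic_irr_moebius:
  fixes \<alpha> :: "'a::finite_field alg_closure"
  assumes \<alpha>: "\<alpha> \<in> quartic_irr" and b: "b \<noteq> 0"
  shows "to_ac a + to_ac b / (\<alpha> + to_ac c) \<in> quartic_irr"
proof -
  have "frob (frob \<alpha>) + to_ac c \<noteq> 0" "\<alpha> + to_ac c \<noteq> 0"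
  proof -
    show 1: "\<alpha> + to_ac c \<noteq> 0"
    proof
      assume "\<alpha> + to_ac c = 0"
      then have "\<alpha> = to_ac (- c)" by (simp add: eq_neg_iff_add_eq_0)
      then show False using quartic_irr_irrational[OF \<alpha>] by blast
    qed
    have "frob (frob (\<alpha> + to_ac c)) \<noteq> 0" using 1 by (simp del: frob_add)
    then show "frob (frob \<alpha>) + to_ac c \<noteq> 0" by simp
  qed
  then show ?thesis using \<alpha> b by (simp add: quartic_irr_def frac_eq_eq)
qed

text \<open>Clearing denominators gives a polynomial of degree at most two over the base field with
  root \<alpha>; hence all its coefficients vanish.\<close>

lemma quartic_irr_moebius_inj:
  fixes \<alpha> :: "'a::finite_field alg_closure"
  assumes \<alpha>: "\<alpha> \<in> quartic_irr" and b: "b \<noteq> 0" "b' \<noteq> 0"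
    and e: "to_ac a + to_ac b / (\<alpha> + to_ac c) = to_ac a' + to_ac b' / (\<alpha> + to_ac c')"
  shows "a = a' \<and> b = b' \<and> c = c'"
proof -
  have nz: "\<alpha> + to_ac x \<noteq> 0" for x
  proof
    assume "\<alpha> + to_ac x = 0"
    then have "\<alpha> = to_ac (- x)" by (simp add: eq_neg_iff_add_eq_0)
    then show False using quartic_irr_irrational[OF \<alpha>] by blast
  qed
  define p where "p = [:(a - a') * c * c' + b * c' - b' * c, (a - a') * (c + c') + b - b', a - a':]"
  let ?u = "\<alpha> + to_ac c" and ?v = "\<alpha> + to_ac c'"
  have "(to_ac a + to_ac b / ?u) * (?u * ?v) = (to_ac a' + to_ac b' / ?v) * (?u * ?v)" by (simp only: e)
  moreover have "to_ac b / ?u * (?u * ?v) = to_ac b * ?v" "to_ac b' / ?v * (?u * ?v) = to_ac b' * ?u"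
    using nz[of c] nz[of c'] by simp_all
  ultimately have "to_ac a * (?u * ?v) + to_ac b * ?v = to_ac a' * (?u * ?v) + to_ac b' * ?u"
    by (simp only: distrib_right)
  then have "poly (ac_poly p) \<alpha> = 0"
    by (simp add: p_def algebra_simps)
  moreover have "degree p \<le> 2" by (simp add: p_def)
  moreover have "frob (frob \<alpha>) \<noteq> \<alpha>" using \<alpha> by (simp add: quartic_irr_def)
  ultimately have "p = 0" using ac_poly_zero_if_root_degree_2 by blast
  then have "a = a'" "b = b'" "b * c' - b' * c = 0" by (auto simp: p_def)
  then show ?thesis using b by simp
qed

text \<open>Two Wronskians are monic quartics, so if they share the root \<alpha> their difference
  has degree at most three and vanishes. Equality fixes \<open>g0\<close> and \<open>h1\<close>,
  expresses \<open>g1\<close> by \<open>h0\<close>, and leaves a quadratic equation for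
  \<open>h0\<close>.\<close>

lemma card_classes_at_quartic_point:
  fixes \<alpha> :: "'a::finite_field alg_closure"
  assumes two: "(2::'a) \<noteq> 0" and three: "(3::'a) \<noteq> 0" and \<alpha>: "\<alpha> \<in> quartic_irr"
  shows "card {C. C \<notin> rational_ram_classes \<and> (\<exists>\<gamma>. ramified_class C \<alpha> \<gamma>)} \<le> 2"
proof -
  let ?X = "{C. C \<notin> rational_ram_classes \<and> (\<exists>\<gamma>. ramified_class C \<alpha> \<gamma>)}"
  have nf: "\<exists>g0 g1 h0 h1. C = pair_class [:g0, g1, 0, 1:] [:h0, h1, 1:] \<and>
      poly (ac_poly (wronskian g0 g1 h0 h1)) \<alpha> = 0" if C: "C \<in> ?X" for C
  proof -
    obtain \<gamma> g h where gh: "cubic g h" "C = pair_class g h" "ramified g h \<alpha> \<gamma>"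
      using C by (auto simp: ramified_class_def)
    have nr: "pair_class g h \<notin> rational_ram_classes" using C gh(2) by simp
    obtain g0 g1 h0 h1 where le: "left_equiv g h [:g0, g1, 0, 1:] [:h0, h1, 1:]"
      and "\<forall>r. poly (wronskian g0 g1 h0 h1) r \<noteq> 0"
      by (rule cubic_normal_form[OF three gh(1) nr])
    show ?thesis
      using cubic_left_equiv(2)[OF gh(1) le, symmetric] gh(2)
        wronskian_root_if_ramified[OF ramified_left_equiv[OF le gh(3)]] by blast
  qed
  show ?thesis
  proof (cases "?X = {}")
    case True
    then show ?thesis by (simp only: card.empty)
  next
    case False
    then obtain C' where "C' \<in> ?X" by blast
    then obtain g0' g1' h0' h1' where w': "poly (ac_poly (wronskian g0' g1' h0' h1')) \<alpha> = 0"
      using nf by blast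
    \<comment> \<open>The primed coefficients belong to a reference class. \<open>F\<close> recovers
      a class from its \<open>h0\<close>, and \<open>Q\<close> is the equation from comparing
      constant coefficients of the Wronskians.\<close>
    define F where "F = (\<lambda>x. pair_class [:g0', g1' + 3 * (x - h0'), 0, 1:] [:x, h1', 1:])"
    define Q where "Q = [:- g1' * h0', g1' - 3 * h0', 3:]"
    have "C \<in> F ` {x. poly Q x = 0}" if C0: "C \<in> ?X" for C
    proof -
      obtain g0 g1 h0 h1 where C: "C = pair_class [:g0, g1, 0, 1:] [:h0, h1, 1:]"
        and w: "poly (ac_poly (wronskian g0 g1 h0 h1)) \<alpha> = 0" using nf[OF C0] by blast
      define p where "p = [:g1 * h0 - g0 * h1 - (g1' * h0' - g0' * h1'), - 2 * (g0 - g0'),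
        3 * h0 - g1 - (3 * h0' - g1'), 2 * (h1 - h1'):]"
      have "poly (ac_poly p) \<alpha> = poly (ac_poly (wronskian g0 g1 h0 h1)) \<alpha> -
          poly (ac_poly (wronskian g0' g1' h0' h1')) \<alpha>"
        by (simp add: p_def wronskian_def algebra_simps)
      then have "poly (ac_poly p) \<alpha> = 0" unfolding w w' by simp
      moreover have "degree p \<le> 3" by (simp add: p_def)
      ultimately have p0: "p = 0" using ac_poly_zero_if_root_degree_3[OF \<alpha>] by blast
      then have 1: "g0 = g0'" "h1 = h1'" using two by (simp_all add: p_def)
      have 2: "g1 = g1' + 3 * (h0 - h0')" using p0 by (simp add: p_def algebra_simps)
      have 3: "g1 * h0 - g0 * h1 = g1' * h0' - g0' * h1'" using p0 by (simp add: p_def)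
      have "poly Q h0 = 0" using 3 unfolding 1 2 Q_def by (simp add: algebra_simps)
      then show ?thesis unfolding C F_def 1 2 by blast
    qed
    then have sub: "?X \<subseteq> F ` {x. poly Q x = 0}" by blast
    have Q: "Q \<noteq> 0" using three by (simp add: Q_def)
    have "card ?X \<le> card (F ` {x. poly Q x = 0})" by (rule card_mono[OF _ sub]) simp
    also have "\<dots> \<le> card {x. poly Q x = 0}" by (rule card_image_le) simp
    also have "\<dots> \<le> degree Q" by (rule card_poly_roots_bound[OF Q])
    also have "\<dots> \<le> 2" by (simp add: Q_def)
    finally show ?thesis .
  qed
qed

definition quartic_classes :: "'a::finite_field poly fract set set" where
  "quartic_classes = {C \<in> cubic_classes. C \<notin> rational_ram_classes \<and>
    (\<exists>\<alpha>\<in>quartic_irr. \<exists>\<gamma>. ramified_class C \<alpha> \<gamma>)}"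

lemma card_quartic_classes:
  assumes two: "(2::'a::finite_field) \<noteq> 0" and three: "(3::'a) \<noteq> 0"
  shows "card (UNIV :: 'a set) ^ 2 * (card (UNIV :: 'a set) - 1) * card (quartic_classes :: 'a poly fract set set)
    \<le> 2 * card (UNIV :: 'a set) ^ 4"
proof -
  let ?q = "card (UNIV :: 'a set)" and ?V = "quartic_classes :: 'a poly fract set set"
  have fin: "finite ?V"
    by (rule finite_subset[OF _ finite_cubic_classes]) (auto simp: quartic_classes_def)
  have "?q ^ 2 * (?q - 1) * card ?V \<le> 2 * card (quartic_irr :: 'a alg_closure set)"
  proof (rule double_count[where P = "\<lambda>C \<alpha>. \<exists>\<gamma>. ramified_class C \<alpha> \<gamma>", OF fin card_quartic_irr(1)])
    fix C :: "'a poly fract set" assume "C \<in> ?V"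
    then obtain \<alpha> \<gamma> where \<alpha>: "\<alpha> \<in> quartic_irr" and r: "ramified_class C \<alpha> \<gamma>"
      by (auto simp: quartic_classes_def)
    \<comment> \<open>The triples parametrize the Moebius transformations that do not fix
      infinity.\<close>
    define D :: "('a \<times> 'a \<times> 'a) set" where "D = (UNIV - {0}) \<times> UNIV \<times> UNIV"
    define f where "f = (\<lambda>(b, a, c). to_ac a + to_ac b / (\<alpha> + to_ac c))"
    have "card D = (?q - 1) * (?q * ?q)"
      unfolding D_def card_cartesian_product by (simp add: card_Diff_singleton)
    then have D: "card D = ?q ^ 2 * (?q - 1)" by (simp add: power2_eq_square)
    have inj: "inj_on f D"
    proof (rule inj_onI)
      fix x y assume xy: "x \<in> D" "y \<in> D" "f x = f y"
      obtain b a c b' a' c' where x: "x = (b, a, c)" and y: "y = (b', a', c')" by (metis prod_cases3)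
      have "a = a' \<and> b = b' \<and> c = c'"
        by (rule quartic_irr_moebius_inj[OF \<alpha>]) (use xy in \<open>simp_all add: x y f_def D_def\<close>)
      then show "x = y" by (simp add: x y)
    qed
    have sub: "f ` D \<subseteq> {\<alpha> \<in> quartic_irr. \<exists>\<gamma>. ramified_class C \<alpha> \<gamma>}"
    proof
      fix \<beta> assume "\<beta> \<in> f ` D"
      then obtain b a c where b: "b \<noteq> 0" and \<beta>: "\<beta> = to_ac a + to_ac b / (\<alpha> + to_ac c)"
        by (auto simp: f_def D_def)
      have nz: "\<alpha> + to_ac c \<noteq> 0"
      proof
        assume "\<alpha> + to_ac c = 0"
        then have "\<alpha> = to_ac (- c)" by (simp add: eq_neg_iff_add_eq_0)
        then show False using quartic_irr_irrational[OF \<alpha>] by blast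
      qed
      \<comment> \<open>Since roots move by the inverse substitution, this matrix is chosen so that
        \<alpha> goes to \<beta>; its determinant is \<open>- b\<close>.\<close>
      have det: "c * a - (- (a * c + b)) * (- 1) \<noteq> 0" using b by (simp add: mult.commute)
      have "(\<alpha> * to_ac a - to_ac (- (a * c + b))) / (to_ac c - \<alpha> * to_ac (- 1)) = \<beta>"
        unfolding \<beta> using nz by (simp add: field_simps)
      then have "\<exists>\<gamma>. ramified_class C \<beta> \<gamma>"
        using ramified_class_moebius[OF r quartic_irr_irrational[OF \<alpha>] det] by metis
      moreover have "\<beta> \<in> quartic_irr" unfolding \<beta> by (rule quartic_irr_moebius[OF \<alpha> b])
      ultimately show "\<beta> \<in> {\<alpha> \<in> quartic_irr. \<exists>\<gamma>. ramified_class C \<alpha> \<gamma>}" by blast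
    qed
    have "card D = card (f ` D)" using card_image[OF inj] by simp
    also have "\<dots> \<le> card {\<alpha> \<in> quartic_irr. \<exists>\<gamma>. ramified_class C \<alpha> \<gamma>}"
      by (rule card_mono[OF _ sub]) (simp add: card_quartic_irr(1))
    finally show "?q ^ 2 * (?q - 1) \<le> card {\<alpha> \<in> quartic_irr. \<exists>\<gamma>. ramified_class C \<alpha> \<gamma>}"
      unfolding D .
  next
    fix \<alpha> :: "'a alg_closure" assume \<alpha>: "\<alpha> \<in> quartic_irr"
    let ?X = "{C :: 'a poly fract set. C \<notin> rational_ram_classes \<and> (\<exists>\<gamma>. ramified_class C \<alpha> \<gamma>)}"
    have "?X \<subseteq> cubic_classes" unfolding ramified_class_def using cubic_classesI by blast
    then have "finite ?X" using finite_cubic_classes by (rule finite_subset)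
    then have "card {C \<in> ?V. \<exists>\<gamma>. ramified_class C \<alpha> \<gamma>} \<le> card ?X"
      by (rule card_mono) (auto simp: quartic_classes_def)
    then show "card {C \<in> ?V. \<exists>\<gamma>. ramified_class C \<alpha> \<gamma>} \<le> 2"
      using card_classes_at_quartic_point[OF two three \<alpha>] by linarith
  qed
  also have "\<dots> \<le> 2 * ?q ^ 4" using card_quartic_irr(2) by simp
  finally show ?thesis .
qed

section \<open>Ramification points of degree two\<close>

definition quadratic_irr :: "'a::finite_field alg_closure set" where
  "quadratic_irr = {\<alpha>. frob (frob \<alpha>) = \<alpha> \<and> frob \<alpha> \<noteq> \<alpha>}"

lemma quadratic_irr_irrational: "\<alpha> \<in> quadratic_irr \<Longrightarrow> \<alpha> \<notin> range to_ac"
  by (auto simp: quadratic_irr_def)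

text \<open>Together with the base field, from which they are disjoint, these points satisfy
  \<open>x ^ (q ^ 2) = x\<close>.\<close>

lemma card_quadratic_irr:
  "finite (quadratic_irr :: 'a::finite_field alg_closure set)"
  "card (quadratic_irr :: 'a::finite_field alg_closure set) + card (UNIV :: 'a set) \<le> card (UNIV :: 'a set) ^ 2"
proof -
  let ?q = "card (UNIV :: 'a set)" and ?I = "quadratic_irr :: 'a alg_closure set"
  have q: "?q ^ 2 \<ge> 2"
    using power_mono[OF card_field_ge_2[where 'a = 'a], of 2] by simp
  note F = card_power_fixed_le[OF q, where 'b = "'a alg_closure"]
  have e: "frob (frob x) = x ^ (?q ^ 2)" for x :: "'a alg_closure"
    by (simp add: frob_def power2_eq_square flip: power_mult)
  have sub: "?I \<union> range to_ac \<subseteq> {x. x ^ (?q ^ 2) = x}"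
    unfolding e[symmetric] by (auto simp: quadratic_irr_def)
  then show fin: "finite ?I" using F(1) finite_subset by blast
  have disj: "?I \<inter> range to_ac = {}" using quadratic_irr_irrational by blast
  have "card (range (to_ac :: 'a \<Rightarrow> _)) = ?q" by (intro card_image injI) simp
  then have "card ?I + ?q = card (?I \<union> range to_ac)"
    using card_Un_disjoint[OF fin _ disj] by simp
  also have "\<dots> \<le> ?q ^ 2" using card_mono[OF F(1) sub] F(2) by linarith
  finally show "card ?I + ?q \<le> ?q ^ 2" .
qed

lemma quadratic_basis:
  fixes \<alpha> \<beta> :: "'a::finite_field alg_closure"
  assumes \<alpha>: "\<alpha> \<in> quadratic_irr" and \<beta>: "frob (frob \<beta>) = \<beta>"
  obtains a b where "\<beta> = to_ac a + to_ac b * \<alpha>"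
proof -
  have n: "\<alpha> - frob \<alpha> \<noteq> 0" and f: "frob (frob \<alpha>) = \<alpha>" using \<alpha> by (auto simp: quadratic_irr_def)
  \<comment> \<open>Subtracting the conjugate of \<open>\<beta> = a + b * \<alpha>\<close> isolates
    \<open>b\<close>; both coordinates are then fixed by \<open>frob\<close>.\<close>
  define b where "b = (\<beta> - frob \<beta>) / (\<alpha> - frob \<alpha>)"
  define a where "a = \<beta> - b * \<alpha>"
  have "frob b = (- (\<beta> - frob \<beta>)) / (- (\<alpha> - frob \<alpha>))" by (simp add: b_def f \<beta>)
  then have fb: "frob b = b" unfolding minus_divide_divide by (simp add: b_def)
  have "b * (\<alpha> - frob \<alpha>) = \<beta> - frob \<beta>" using n by (simp add: b_def)
  then have "frob a = a" by (simp add: a_def fb algebra_simps)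
  then obtain a' b' where ab: "a = to_ac a'" "b = to_ac b'" using fb frob_fixed_iff by (metis imageE)
  have "\<beta> = a + b * \<alpha>" by (simp add: a_def)
  then show ?thesis unfolding ab by (rule that)
qed

lemma quadratic_basis_unique:
  assumes \<alpha>: "\<alpha> \<notin> range to_ac" and e: "to_ac a - \<alpha> * to_ac b = to_ac a' - \<alpha> * to_ac b'"
  shows "a = a' \<and> b = b'"
proof -
  have "b = b'"
  proof (rule ccontr)
    assume n: "b \<noteq> b'"
    have "\<alpha> * to_ac (b - b') = to_ac (a - a')" using e by (simp add: algebra_simps)
    then have "\<alpha> = to_ac ((a - a') / (b - b'))" using n by (simp add: field_simps)
    then show False using \<alpha> by blast
  qed
  then show ?thesis using e by simp
qed

lemma map_poly_frob2_ac_poly: "map_poly (\<lambda>x. frob (frob x)) (ac_poly p) = ac_poly p"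
  by (rule poly_eqI) (simp add: coeff_map_poly)

text \<open>The pencil spanned by \<open>g\<close> and \<open>h\<close> over the quadratic extension contains
  \<open>(x - \<alpha>)\<^sup>2 (x - \<gamma>)\<close>; splitting its coefficients along the basis \<open>1, \<alpha>\<close> gives the
  normal form.\<close>

lemma quadratic_normal_form:
  fixes g h :: "'a::finite_field poly"
  assumes c: "cubic g h" and \<alpha>: "\<alpha> \<in> quadratic_irr" and r: "ramified g h \<alpha> \<gamma>"
  obtains g' h' where "left_equiv g h g' h'"
    "ac_poly g' - smult \<alpha> (ac_poly h') = [:-\<alpha>, 1:]^2 * [:-\<gamma>, 1:]"
    "\<gamma> \<in> quadratic_irr"
proof -
  note irr = quadratic_irr_irrational[OF \<alpha>]
  have f\<alpha>: "frob (frob \<alpha>) = \<alpha>" using \<alpha> by (auto simp: quadratic_irr_def)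
  obtain s t where st: "smult s (ac_poly g) + smult t (ac_poly h) = [:-\<alpha>, 1:]^2 * [:-\<gamma>, 1:]"
    using r by (auto simp: ramified_def)
  have P0: "[:-\<alpha>, 1:]^2 * [:-\<gamma>, 1:] \<noteq> 0" by (simp del: mult_pCons_right)
  have st0: "s \<noteq> 0 \<or> t \<noteq> 0" using st P0 by (metis add_0 smult_0_left)
  have dvd: "[:-\<alpha>, 1:]^2 dvd smult s (ac_poly g) + smult t (ac_poly h)" by (simp only: st dvd_triv_left)
  have s0: "s \<noteq> 0"
    using pencil_ratio_irrational[OF c irr _ dvd st0, of 1 0] by fastforce
  define \<tau> where "\<tau> = t / s"
  let ?ff = "\<lambda>x :: 'a alg_closure. frob (frob x)"
  note ff_hom = map_poly_hom[of ?ff, simplified]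
  have "smult (inverse s) (smult s (ac_poly g) + smult t (ac_poly h)) = smult 1 (ac_poly g) + smult \<tau> (ac_poly h)"
    using s0 by (simp add: smult_add_right \<tau>_def divide_inverse mult.commute)
  then have e: "ac_poly g + smult \<tau> (ac_poly h) = smult (inverse s) ([:-\<alpha>, 1:]^2 * [:-\<gamma>, 1:])"
    unfolding st by simp
  have ffP: "map_poly ?ff [:-\<beta>, 1:] = [:- ?ff \<beta>, 1:]" for \<beta>
    by (simp add: map_poly_pCons)
  have "map_poly ?ff (ac_poly g + smult \<tau> (ac_poly h)) =
      smult (?ff (inverse s)) ([:-\<alpha>, 1:]^2 * [:- ?ff \<gamma>, 1:])"
    unfolding e power2_eq_square ff_hom ffP f\<alpha> ..
  then have e2: "ac_poly g + smult (?ff \<tau>) (ac_poly h) = smult (?ff (inverse s)) ([:-\<alpha>, 1:]^2 * [:- ?ff \<gamma>, 1:])"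
    unfolding ff_hom map_poly_frob2_ac_poly .
  \<comment> \<open>Otherwise subtracting the two normalized members would leave a multiple of
    \<open>h\<close> with the double root \<alpha>.\<close>
  have f\<tau>: "?ff \<tau> = \<tau>"
  proof (rule ccontr)
    assume n: "?ff \<tau> \<noteq> \<tau>"
    have "[:-\<alpha>, 1:]^2 dvd (ac_poly g + smult \<tau> (ac_poly h)) - (ac_poly g + smult (?ff \<tau>) (ac_poly h))"
      unfolding e e2 by (intro dvd_diff dvd_smult dvd_triv_left)
    then have "[:-\<alpha>, 1:]^2 dvd smult (\<tau> - ?ff \<tau>) (ac_poly h)" by (simp add: smult_diff_left)
    then have "[:-\<alpha>, 1:]^2 dvd smult (to_ac 0) (ac_poly g) + smult (to_ac 1) (ac_poly h)"
      using n by (simp add: dvd_smult_iff)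
    then show False using no_irrational_double_root_pencil[OF c irr, of 0 1] by simp
  qed
  \<comment> \<open>The cubic coefficient shows that \<open>s\<close> is fixed by the square of
    \<open>frob\<close>; the quadratic one then shows the same for \<gamma>.\<close>
  have P: "coeff ([:-\<alpha>, 1:]^2 * [:-\<beta>, 1:]) 3 = 1" "coeff ([:-\<alpha>, 1:]^2 * [:-\<beta>, 1:]) 2 = - (2 * \<alpha> + \<beta>)" for \<beta>
    by (simp_all add: power2_eq_square numeral_3_eq_3 numeral_2_eq_2 algebra_simps)
  have eq: "smult (inverse s) ([:-\<alpha>, 1:]^2 * [:-\<gamma>, 1:]) = smult (?ff (inverse s)) ([:-\<alpha>, 1:]^2 * [:- ?ff \<gamma>, 1:])"
    using e e2 f\<tau> by simp
  from arg_cong[OF eq, of "\<lambda>p. coeff p 3"] have fis: "?ff (inverse s) = inverse s"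
    unfolding coeff_smult P by simp
  from arg_cong[OF eq, of "\<lambda>p. coeff p 2"] have f\<gamma>: "?ff \<gamma> = \<gamma>"
    unfolding coeff_smult P fis using s0 by simp
  have "?ff s * ?ff (inverse s) = 1" using s0 by (simp flip: frob_mult)
  then have fs: "?ff s = s" unfolding fis using s0 by (simp add: field_simps)
  have "t = \<tau> * s" using s0 by (simp add: \<tau>_def)
  then have ft: "?ff t = t" using f\<tau> fs by simp
  obtain a b where ab: "s = to_ac a + to_ac b * \<alpha>" using quadratic_basis[OF \<alpha> fs] .
  obtain a' b' where ab': "t = to_ac a' + to_ac b' * \<alpha>" using quadratic_basis[OF \<alpha> ft] .
  \<comment> \<open>Collecting the parts without and with \<alpha> in \<open>s g + t h\<close>; the
    minus signs match the form \<open>g' - \<alpha> h'\<close>.\<close>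
  define g' h' where "g' = smult a g + smult a' h" and "h' = smult (- b) g + smult (- b') h"
  \<comment> \<open>A zero determinant would make the coordinate vectors of \<open>s\<close> and
    \<open>t\<close> proportional, hence their ratio rational.\<close>
  have det: "a * (- b') - a' * (- b) \<noteq> 0"
  proof
    assume "a * (- b') - a' * (- b) = 0"
    then have z: "a * b' = a' * b" by simp
    then have z': "to_ac a * to_ac b' = to_ac a' * to_ac b" by (metis to_ac_mult)
    have "s * to_ac b' + t * to_ac (- b) = 0" "s * to_ac a' + t * to_ac (- a) = 0"
      unfolding ab ab' using z' by (simp_all add: algebra_simps)
    moreover have "(b' \<noteq> 0 \<or> - b \<noteq> 0) \<or> (a' \<noteq> 0 \<or> - a \<noteq> 0)" using s0 ab by auto
    ultimately show False using pencil_ratio_irrational[OF c irr _ dvd st0] by blast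
  qed
  have "left_equiv g h g' h'" by (rule left_equivI[OF det g'_def h'_def])
  moreover have "ac_poly g' - smult \<alpha> (ac_poly h') = [:-\<alpha>, 1:]^2 * [:-\<gamma>, 1:]"
    unfolding st[symmetric] g'_def h'_def ab ab' ac_poly_hom
    by (simp add: smult_add_left smult_diff_left smult_add_right smult_diff_right mult.commute algebra_simps)
  moreover have "\<gamma> \<in> quadratic_irr"
    using ramified_irrational[OF c irr r] f\<gamma> frob_fixed_iff[of \<gamma>] by (auto simp: quadratic_irr_def)
  ultimately show ?thesis by (rule that)
qed

text \<open>The right side of the normal form depends only on \<alpha> and \<gamma>. Since
  \<open>1\<close> and \<alpha> are independent over the base field, it determines both
  polynomials.\<close>

lemma ramified_class_quadratic_unique:
  fixes C C' :: "'a::finite_field poly fract set"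
  assumes \<alpha>: "\<alpha> \<in> quadratic_irr" and C: "ramified_class C \<alpha> \<gamma>" and C': "ramified_class C' \<alpha> \<gamma>"
  shows "C = C'"
proof -
  have nf: "\<exists>g' h'. C = pair_class g' h' \<and> ac_poly g' - smult \<alpha> (ac_poly h') = [:-\<alpha>, 1:]^2 * [:-\<gamma>, 1:]"
    if C: "ramified_class C \<alpha> \<gamma>" for C :: "'a poly fract set"
  proof -
    obtain g h where gh: "cubic g h" "C = pair_class g h" "ramified g h \<alpha> \<gamma>"
      using C by (auto simp: ramified_class_def)
    obtain g' h' where le: "left_equiv g h g' h'"
      and e: "ac_poly g' - smult \<alpha> (ac_poly h') = [:-\<alpha>, 1:]^2 * [:-\<gamma>, 1:]"
      and "\<gamma> \<in> quadratic_irr" by (rule quadratic_normal_form[OF gh(1) \<alpha> gh(3)])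
    show ?thesis using cubic_left_equiv(2)[OF gh(1) le] gh(2) e by (intro exI[of _ g'] exI[of _ h']) simp
  qed
  obtain g h where 1: "C = pair_class g h" "ac_poly g - smult \<alpha> (ac_poly h) = [:-\<alpha>, 1:]^2 * [:-\<gamma>, 1:]"
    using nf[OF C] by blast
  obtain g' h' where 2: "C' = pair_class g' h'" "ac_poly g' - smult \<alpha> (ac_poly h') = [:-\<alpha>, 1:]^2 * [:-\<gamma>, 1:]"
    using nf[OF C'] by blast
  have "coeff (ac_poly g - smult \<alpha> (ac_poly h)) n = coeff (ac_poly g' - smult \<alpha> (ac_poly h')) n" for n
    by (simp only: 1(2) 2(2))
  then have "to_ac (coeff g n) - \<alpha> * to_ac (coeff h n) = to_ac (coeff g' n) - \<alpha> * to_ac (coeff h' n)" for n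
    by (simp add: coeff_map_poly)
  then have "coeff g n = coeff g' n \<and> coeff h n = coeff h' n" for n
    by (rule quadratic_basis_unique[OF quadratic_irr_irrational[OF \<alpha>]])
  then have "g = g'" "h = h'" by (simp_all add: poly_eq_iff)
  then show ?thesis by (simp only: 1(1) 2(1))
qed

text \<open>If \<gamma> were \<open>frob \<alpha>\<close>, then \<open>g' - \<alpha> h'\<close> and
  its conjugate would both vanish at \<open>frob \<alpha>\<close>, which would be a common root of
  \<open>g'\<close> and \<open>h'\<close>.\<close>

lemma ramified_class_quadratic_irr:
  assumes \<alpha>: "\<alpha> \<in> quadratic_irr" and C: "ramified_class C \<alpha> \<gamma>"
  shows "\<gamma> \<in> quadratic_irr" "\<gamma> \<noteq> frob \<alpha>"
proof -
  obtain g h where gh: "cubic g h" "C = pair_class g h" "ramified g h \<alpha> \<gamma>"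
    using C by (auto simp: ramified_class_def)
  obtain g' h' where le: "left_equiv g h g' h'"
    and e: "ac_poly g' - smult \<alpha> (ac_poly h') = [:-\<alpha>, 1:]^2 * [:-\<gamma>, 1:]"
    and \<gamma>: "\<gamma> \<in> quadratic_irr" by (rule quadratic_normal_form[OF gh(1) \<alpha> gh(3)])
  show "\<gamma> \<in> quadratic_irr" by (rule \<gamma>)
  show "\<gamma> \<noteq> frob \<alpha>"
  proof
    assume g: "\<gamma> = frob \<alpha>"
    have f: "frob (frob \<alpha>) = \<alpha>" "frob \<alpha> \<noteq> \<alpha>" using \<alpha> by (auto simp: quadratic_irr_def)
    let ?G = "poly (ac_poly g')" and ?H = "poly (ac_poly h')"
    have v: "?G x - \<alpha> * ?H x = (x - \<alpha>)^2 * (x - frob \<alpha>)" for x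
    proof -
      have "?G x - \<alpha> * ?H x = poly (ac_poly g' - smult \<alpha> (ac_poly h')) x" by simp
      then show ?thesis unfolding e g poly_mult poly_power by simp
    qed
    have 1: "?G (frob \<alpha>) - \<alpha> * ?H (frob \<alpha>) = 0" unfolding v by simp
    have "frob (?G \<alpha> - \<alpha> * ?H \<alpha>) = 0" unfolding v by simp
    then have 2: "?G (frob \<alpha>) - frob \<alpha> * ?H (frob \<alpha>) = 0" by (simp add: poly_ac_poly_frob)
    have "(frob \<alpha> - \<alpha>) * ?H (frob \<alpha>) = (?G (frob \<alpha>) - \<alpha> * ?H (frob \<alpha>)) - (?G (frob \<alpha>) - frob \<alpha> * ?H (frob \<alpha>))"
      by (simp add: algebra_simps)
    then have "(frob \<alpha> - \<alpha>) * ?H (frob \<alpha>) = 0" unfolding 1 2 by simp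
    then have H: "?H (frob \<alpha>) = 0" using f(2) by simp
    then have "?G (frob \<alpha>) = 0" using 1 by simp
    then show False using cubic_common_root_ac[OF cubic_left_equiv(1)[OF gh(1) le] _ H] by simp
  qed
qed

text \<open>An affine map over the base field carries \<beta> to \<alpha>, so all classes can be
  counted at one fixed point.\<close>

lemma ramified_class_quadratic_move:
  fixes \<alpha> \<beta> :: "'a::finite_field alg_closure"
  assumes \<alpha>: "\<alpha> \<in> quadratic_irr" and \<beta>: "\<beta> \<in> quadratic_irr" and C: "ramified_class C \<beta> \<gamma>"
  obtains \<gamma>' where "ramified_class C \<alpha> \<gamma>'"
proof -
  have "frob (frob \<beta>) = \<beta>" using \<beta> by (simp add: quadratic_irr_def)
  then obtain b a where ab: "\<beta> = to_ac b + to_ac a * \<alpha>" by (rule quadratic_basis[OF \<alpha>])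
  have a: "a \<noteq> 0" using quadratic_irr_irrational[OF \<beta>] ab by auto
  have det: "a * 1 - b * 0 \<noteq> 0" using a by simp
  have "(\<beta> * to_ac 1 - to_ac b) / (to_ac a - \<beta> * to_ac 0) = \<alpha>" using a by (simp add: ab)
  then show ?thesis using ramified_class_moebius[OF C quadratic_irr_irrational[OF \<beta>] det] that by simp
qed

text \<open>The substitutions \<open>x \<mapsto> (t x + n) / (- x + t + \<tau>)\<close> and the identity represent the
  stabilizer of \<open>\<alpha>\<close>, where \<open>\<tau>\<close> and \<open>n\<close> are the trace and the norm of \<open>\<alpha>\<close>.\<close>

lemma card_ramified_class_quadratic:
  fixes C :: "'a::finite_field poly fract set"
  assumes \<alpha>: "\<alpha> \<in> quadratic_irr" and C: "ramified_class C \<alpha> \<gamma>" and \<gamma>\<alpha>: "\<gamma> \<noteq> \<alpha>"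
  shows "card (UNIV :: 'a set) \<le> card {\<gamma> \<in> quadratic_irr. ramified_class C \<alpha> \<gamma>}"
proof -
  have f\<alpha>: "frob (frob \<alpha>) = \<alpha>" using \<alpha> by (auto simp: quadratic_irr_def)
  note irr = quadratic_irr_irrational[OF \<alpha>]
  note \<gamma> = ramified_class_quadratic_irr[OF \<alpha> C]
  have "frob (\<alpha> + frob \<alpha>) = \<alpha> + frob \<alpha>" "frob (\<alpha> * frob \<alpha>) = \<alpha> * frob \<alpha>"
    by (simp_all add: f\<alpha> add.commute mult.commute)
  then obtain \<tau> n where \<tau>: "to_ac \<tau> = \<alpha> + frob \<alpha>" and n: "to_ac n = \<alpha> * frob \<alpha>"
    unfolding frob_fixed_iff by (metis imageE)
  have nz: "to_ac t + x \<noteq> 0" if x: "x \<notin> range to_ac" for x t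
  proof
    assume "to_ac t + x = 0"
    then have "x = to_ac (- t)" by (simp add: eq_neg_iff_add_eq_0 add.commute)
    then show False using x by blast
  qed
  have f\<alpha>irr: "frob \<alpha> \<notin> range to_ac" using \<alpha> f\<alpha> by (auto simp: quadratic_irr_def)
  note nz\<alpha> = nz[OF irr] and nzf = nz[OF f\<alpha>irr] and nz\<gamma> = nz[OF quadratic_irr_irrational[OF \<gamma>(1)]]
  define \<delta> where "\<delta> = (\<lambda>t. (\<gamma> * to_ac (t + \<tau>) - to_ac n) / (to_ac t + \<gamma>))"
  have ram: "ramified_class C \<alpha> (\<delta> t)" for t
  proof -
    \<comment> \<open>The determinant is the norm of \<open>t + \<alpha>\<close>.\<close>
    have "to_ac (t * (t + \<tau>) - n * (- 1)) = (to_ac t + \<alpha>) * (to_ac t + frob \<alpha>)"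
      by (simp add: \<tau> n algebra_simps)
    then have det: "t * (t + \<tau>) - n * (- 1) \<noteq> 0"
      using nz\<alpha> nzf by (metis mult_eq_0_iff to_ac_0)
    have "\<alpha> * to_ac (t + \<tau>) - to_ac n = \<alpha> * (to_ac t + \<alpha>)" by (simp add: \<tau> n algebra_simps)
    then have "(\<alpha> * to_ac (t + \<tau>) - to_ac n) / (to_ac t - \<alpha> * to_ac (- 1)) = \<alpha>"
      using nz\<alpha>[of t] by simp
    then show ?thesis using ramified_class_moebius[OF C irr det] by (simp add: \<delta>_def)
  qed
  have inj: "inj \<delta>"
  proof (rule injI)
    fix t u assume e: "\<delta> t = \<delta> u"
    have "(\<gamma> * to_ac (t + \<tau>) - to_ac n) * (to_ac u + \<gamma>) = (\<gamma> * to_ac (u + \<tau>) - to_ac n) * (to_ac t + \<gamma>)"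
      by (rule iffD1[OF frac_eq_eq[OF nz\<gamma> nz\<gamma>] e[unfolded \<delta>_def]])
    \<comment> \<open>The second factor is \<open>\<gamma>^2 - \<tau> \<gamma> + n\<close>, whose
      zeros \<alpha> and \<open>frob \<alpha>\<close> are the two points excluded for
      \<gamma>.\<close>
    moreover have "(\<gamma> * to_ac (t + \<tau>) - to_ac n) * (to_ac u + \<gamma>) - (\<gamma> * to_ac (u + \<tau>) - to_ac n) * (to_ac t + \<gamma>)
        = (to_ac t - to_ac u) * ((\<gamma> - \<alpha>) * (\<gamma> - frob \<alpha>))"
      by (simp add: \<tau> n algebra_simps)
    ultimately have "to_ac t = to_ac u" using \<gamma>(2) \<gamma>\<alpha> by simp
    then show "t = u" by simp
  qed
  have "range \<delta> \<subseteq> {\<gamma> \<in> quadratic_irr. ramified_class C \<alpha> \<gamma>}"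
    using ram ramified_class_quadratic_irr(1)[OF \<alpha> ram] by blast
  then have "card (range \<delta>) \<le> card {\<gamma> \<in> quadratic_irr. ramified_class C \<alpha> \<gamma>}"
    by (rule card_mono[rotated]) (simp add: card_quadratic_irr(1))
  then show ?thesis using card_image[OF inj] by simp
qed

section \<open>Counting the quadratic classes and combining the bounds\<close>

definition quadratic_classes :: "'a::finite_field poly fract set set" where
  "quadratic_classes = {C \<in> cubic_classes. \<exists>\<alpha>\<in>quadratic_irr. \<exists>\<gamma>. ramified_class C \<alpha> \<gamma>}"

lemma card_quadratic_classes:
  "card (quadratic_classes :: 'a::finite_field poly fract set set) \<le> card (UNIV :: 'a set)"
proof (cases "quadratic_classes = ({} :: 'a poly fract set set)")
  case False
  let ?q = "card (UNIV :: 'a set)"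
  obtain \<alpha> :: "'a alg_closure" where \<alpha>: "\<alpha> \<in> quadratic_irr"
    using False by (auto simp: quadratic_classes_def)
  define Y where "Y = {C :: 'a poly fract set. ramified_class C \<alpha> \<alpha>}"
  define Z where "Z = {C :: 'a poly fract set. \<exists>\<gamma>. \<gamma> \<noteq> \<alpha> \<and> ramified_class C \<alpha> \<gamma>}"
  have cub: "C \<in> cubic_classes" if "ramified_class C \<alpha> \<gamma>" for \<gamma> and C :: "'a poly fract set"
    using that cubic_classesI unfolding ramified_class_def by blast
  have fin: "finite Y" "finite Z"
    by (rule finite_subset[OF _ finite_cubic_classes], use cub in \<open>auto simp: Y_def Z_def\<close>)+
  have at_most_1: "card {C \<in> A. ramified_class C \<alpha> \<gamma>} \<le> 1" if "finite A" for A :: "'a poly fract set set" and \<gamma>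
    using card_le_Suc0_iff_eq[of "{C \<in> A. ramified_class C \<alpha> \<gamma>}"] that
      ramified_class_quadratic_unique[OF \<alpha>] by auto
  have Y: "card Y \<le> 1"
    using at_most_1[OF fin(1), of \<alpha>] by (simp add: Y_def)
  \<comment> \<open>Each class in \<open>Z\<close> uses at least \<open>q\<close> values of
    \<gamma>, and each value belongs to at most one class.\<close>
  have "?q * card Z \<le> 1 * card (quadratic_irr :: 'a alg_closure set)"
  proof (rule double_count[where P = "\<lambda>C \<gamma>. ramified_class C \<alpha> \<gamma>", OF fin(2) card_quadratic_irr(1)])
    fix C assume "C \<in> Z"
    then show "?q \<le> card {\<gamma> \<in> quadratic_irr. ramified_class C \<alpha> \<gamma>}"
      using card_ramified_class_quadratic[OF \<alpha>] unfolding Z_def by blast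
  qed (rule at_most_1[OF fin(2)])
  then have "?q * card Z + ?q \<le> ?q * ?q" using card_quadratic_irr(2)[where 'a = 'a]
    by (simp add: power2_eq_square)
  then have qZ: "?q * (card Z + 1) \<le> ?q * ?q" by simp
  have "0 < ?q" using card_field_ge_2[where 'a = 'a] by linarith
  then have Z: "card Z + 1 \<le> ?q" by (rule iffD1[OF nat_mult_le_cancel1 qZ])
  have "quadratic_classes \<subseteq> Y \<union> Z"
  proof
    fix C :: "'a poly fract set" assume "C \<in> quadratic_classes"
    then obtain \<beta> \<gamma> where "\<beta> \<in> quadratic_irr" "ramified_class C \<beta> \<gamma>"
      by (auto simp: quadratic_classes_def)
    then obtain \<gamma>' where "ramified_class C \<alpha> \<gamma>'" by (rule ramified_class_quadratic_move[OF \<alpha>])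
    then show "C \<in> Y \<union> Z" unfolding Y_def Z_def by (cases "\<gamma>' = \<alpha>") auto
  qed
  then have "card (quadratic_classes :: 'a poly fract set set) \<le> card (Y \<union> Z)"
    by (rule card_mono[rotated]) (simp add: fin)
  also have "\<dots> \<le> card Y + card Z" by (rule card_Un_le)
  finally show ?thesis using Y Z by simp
qed simp

text \<open>Outside the rational case the Wronskian is a quartic without rational roots. Any root in
  the closure is a ramification point, of degree two or four according to whether the square of
  \<open>frob\<close> fixes it.\<close>

lemma cubic_classes_cover:
  assumes three: "(3::'a::finite_field) \<noteq> 0"
  shows "cubic_classes \<subseteq> rational_ram_classes \<union> quadratic_classes \<union> (quartic_classes :: 'a poly fract set set)"
proof
  fix C :: "'a poly fract set" assume C: "C \<in> cubic_classes"
  show "C \<in> rational_ram_classes \<union> quadratic_classes \<union> quartic_classes"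
  proof (cases "C \<in> rational_ram_classes")
    case nr: False
    obtain g h where gh: "cubic g h" "C = pair_class g h" using C by (rule cubic_classesE)
    obtain g0 g1 h0 h1 where le: "left_equiv g h [:g0, g1, 0, 1:] [:h0, h1, 1:]"
      and w: "\<forall>r. poly (wronskian g0 g1 h0 h1) r \<noteq> 0"
      by (rule cubic_normal_form[OF three gh(1) nr[unfolded gh(2)]])
    note c = cubic_left_equiv[OF gh(1) le]
    have "degree (ac_poly (wronskian g0 g1 h0 h1)) > 0" by (simp add: wronskian_def)
    then obtain \<alpha> where \<alpha>: "poly (ac_poly (wronskian g0 g1 h0 h1)) \<alpha> = 0"
      using alg_closed_imp_poly_has_root by blast
    have irr: "\<alpha> \<notin> range to_ac"
    proof
      assume "\<alpha> \<in> range to_ac"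
      then obtain x where "\<alpha> = to_ac x" by blast
      then show False using \<alpha> w by (simp add: poly_ac_poly_to_ac)
    qed
    obtain \<gamma> where "ramified [:g0, g1, 0, 1:] [:h0, h1, 1:] \<alpha> \<gamma>"
      by (rule ramified_if_wronskian_root[OF c(1) irr \<alpha>])
    then have r: "ramified_class C \<alpha> \<gamma>"
      unfolding ramified_class_def using c gh(2) by blast
    show ?thesis
    proof (cases "frob (frob \<alpha>) = \<alpha>")
      case True
      then have "\<alpha> \<in> quadratic_irr" using irr frob_fixed_iff[of \<alpha>] by (simp add: quadratic_irr_def)
      then show ?thesis using C r unfolding quadratic_classes_def by blast
    next
      case False
      have "\<alpha> \<in> quartic_irr"
        by (rule quartic_root_in_quartic_irr[OF wronskian_def \<alpha> _ False]) (use w in blast)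
      then show ?thesis using C nr r unfolding quartic_classes_def by blast
    qed
  qed simp
qed

lemma of_nat_less_CHAR_nonzero:
  "0 < n \<Longrightarrow> n < CHAR('a) \<Longrightarrow> (of_nat n :: 'a::semiring_1) \<noteq> 0"
  by (simp add: of_nat_eq_0_iff_char_dvd nat_dvd_not_less)

theorem theorem6p2:
  assumes "CHAR('a::finite_field) \<ge> 5"
  shows "finite (orbits (PGL2 \<times>\<times> PGL2) {R :: 'a poly fract. rat_degree R = 3} rat_action) \<and>
    card (orbits (PGL2 \<times>\<times> PGL2) {R :: 'a poly fract. rat_degree R = 3} rat_action)
      \<le> 6 * card (UNIV :: 'a set) - 2"
proof -
  let ?q = "card (UNIV :: 'a set)"
  have two: "(2::'a) \<noteq> 0" and three: "(3::'a) \<noteq> 0"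
    using of_nat_less_CHAR_nonzero[of 2, where 'a = 'a] of_nat_less_CHAR_nonzero[of 3, where 'a = 'a] assms
    by simp_all
  have q5: "?q \<ge> 5"
  proof -
    have "inj_on (of_nat :: nat \<Rightarrow> 'a) {..<5}"
    proof (rule linorder_inj_onI)
      fix m n :: nat assume "m < n" "n \<in> {..<5}"
      then have "(of_nat (n - m) :: 'a) \<noteq> 0" using assms by (intro of_nat_less_CHAR_nonzero) auto
      then show "(of_nat m :: 'a) \<noteq> of_nat n" using \<open>m < n\<close> by (simp add: of_nat_diff)
    qed auto
    then have "card ((of_nat :: nat \<Rightarrow> 'a) ` {..<5}) = 5" by (simp add: card_image)
    then show ?thesis using card_mono[OF finite subset_UNIV, of "(of_nat :: nat \<Rightarrow> 'a) ` {..<5}"] by simp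
  qed
  let ?A = "rational_ram_classes :: 'a poly fract set set"
    and ?B = "quadratic_classes :: 'a poly fract set set"
    and ?D = "quartic_classes :: 'a poly fract set set"
  have fin: "finite ?B" "finite ?D"
    by (rule finite_subset[OF _ finite_cubic_classes], auto simp: quadratic_classes_def quartic_classes_def)+
  have "card (cubic_classes :: 'a poly fract set set) \<le> card (?A \<union> ?B \<union> ?D)"
    by (rule card_mono[OF _ cubic_classes_cover[OF three]])
       (simp add: fin card_rational_ram_classes(1)[OF two three])
  also have "\<dots> \<le> card ?A + card ?B + card ?D"
    by (meson add_le_mono card_Un_le le_refl order_trans)
  finally have total: "card (cubic_classes :: 'a poly fract set set) \<le> card ?A + card ?B + card ?D" .
  \<comment> \<open>From \<open>2 q + 3\<close> classes on,
    \<open>(q - 1) (2 q + 3) = 2 q^2 + q - 3\<close> would have to be at most \<open>2 q^2\<close>,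
    which fails for \<open>q \<ge> 5\<close>.\<close>
  have D: "card ?D \<le> 2 * ?q + 2"
  proof (rule ccontr)
    assume "\<not> ?thesis"
    then have D3: "2 * ?q + 3 \<le> card ?D" by simp
    obtain r where r: "?q = r + 5" using q5 by (metis le_add_diff_inverse2)
    have "?q ^ 2 * ((?q - 1) * (2 * ?q + 3)) \<le> ?q ^ 2 * ((?q - 1) * card ?D)"
      by (intro mult_le_mono2 D3)
    also have "\<dots> \<le> ?q ^ 2 * (2 * ?q ^ 2)"
      using card_quartic_classes[OF two three] by (simp add: power_def mult_ac numeral_eq_Suc)
    finally have "(?q - 1) * (2 * ?q + 3) \<le> 2 * ?q ^ 2" using q5 by simp
    then show False unfolding r by (simp add: power2_eq_square algebra_simps)
  qed
  \<comment> \<open>The sum \<open>(5 q - 3) / 2 + q + (2 q + 2)\<close> equals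
    \<open>(11 q + 1) / 2\<close>, which is at most \<open>6 q - 2\<close> exactly when
    \<open>q \<ge> 5\<close>.\<close>
  have "card (cubic_classes :: 'a poly fract set set) \<le> 6 * ?q - 2"
    using total D card_quadratic_classes[where 'a = 'a] card_rational_ram_classes(2)[OF two three] q5
    by linarith
  then show ?thesis
    unfolding orbits_eq_rat_class cubic_classes_def[symmetric] using finite_cubic_classes by blast
qed

end
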